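(* Let $0<\beta<\gamma<1$, $0\le\mu\le1$, $x_0>0$ and $p>1/\beta$. Let $l$ be a nonnegative function with $t^{(1-\mu)(1-\beta)}l(t)\in C(0,+\infty)\cap L^{p}_{Loc}[0,+\infty)$, and suppose there exists a nonnegative constant $K$ such that $t^{\gamma}l(t)\le K$ for $t\in[1,+\infty)$. Let $k$ be a nonnegative function with $t^{1-\beta}k(t)\in C(0,+\infty)\cap L^{p}_{Loc}[0,+\infty)$ and $\lim_{t\to+\infty}t^{\beta}k(t)=b\ge0$. Let $\phi$ be a nonnegative and continuous function on $[0,+\infty)$, and suppose there exists a nonnegative constant $M$ such that $|\phi(t)|\le M t^{\mu}$ for all $t\in[0,+\infty)$. Then the Riemann-Liouville fractional differential equation $$D_{0^{+}}^{\beta}x(t)=l(t)\phi(x(t))+k(t),\quad t\in(0,+\infty),\qquad \lim_{t\to0^{+}}t^{1-\beta}x(t)=x_{0},$$ has at least one solution $x\in C^{+}_{1-\beta}(0,+\infty)$ with $$\lim_{t\to+\infty}x(t)=\frac{b\pi}{\Gamma(\beta)\sin(\beta\pi)}.$$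
   Context: The Riemann-Liouville fractional integral of order $\alpha\in(0,1)$ is $I_{0^{+}}^{\alpha}\rho(t)=\frac{1}{\Gamma(\alpha)}\int_{0}^{t}(t-s)^{\alpha-1}\rho(s)\,ds$. The Riemann-Liouville fractional derivative of order $\beta\in(0,1)$ is $D_{0^{+}}^{\beta}\rho(t)=\frac{d}{dt}I_{0^{+}}^{1-\beta}\rho(t)=\frac{1}{\Gamma(1-\beta)}\frac{d}{dt}\int_{0}^{t}(t-s)^{-\beta}\rho(s)\,ds$, where $I_{0^{+}}^{1-\beta}\rho$ is an absolutely continuous function. For $\alpha\in(0,1)$, $C^{+}_{\alpha}(0,+\infty)$ is the set of nonnegative continuous functions $x$ on $(0,+\infty)$ such that $t^{\alpha}x(t)$ is (extends to) a nonnegative continuous function on $[0,+\infty)$. $C(0,+\infty)$ is the set of continuous real-valued functions on $(0,+\infty)$, and $L^{p}_{Loc}[0,+\infty)$ is the space of real-valued functions $f$ for which $|f|^{p}$ is Lebesgue integrable over every bounded subinterval of $[0,+\infty)$. A solution is a function satisfying both the differential equation for all $t\in(0,+\infty)$ and the initial condition. When $\mu=0$, $t^{\mu}=1$ for all $t\ge0$, including $t=0$. *)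

theory Defs
  imports "HOL-Analysis.Analysis"
begin

text \<open>Functions on \<open>(0, \<infinity>)\<close> or \<open>[0, \<infinity>)\<close> are total functions on the reals of which
  only the values on that domain are used.\<close>

text \<open>Here the value of \<open>\<rho>\<close> at 0 is irrelevant. The Bochner integral of a non-integrable
  function is 0 by convention, so \<open>rl_integral\<close> is meaningful only together with
  \<open>rl_integrable\<close>.\<close>

definition rl_integrable :: "real \<Rightarrow> (real \<Rightarrow> real) \<Rightarrow> real \<Rightarrow> bool" where
  "rl_integrable \<alpha> \<rho> t \<longleftrightarrow> set_integrable lebesgue {0..t} (\<lambda>s. (t - s) powr (\<alpha> - 1) * \<rho> s)"

definition rl_integral :: "real \<Rightarrow> (real \<Rightarrow> real) \<Rightarrow> real \<Rightarrow> real" where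
  "rl_integral \<alpha> \<rho> t =
     1 / Gamma \<alpha> * set_lebesgue_integral lebesgue {0..t} (\<lambda>s. (t - s) powr (\<alpha> - 1) * \<rho> s)"

text \<open>A pair \<open>(a, b)\<close> in \<open>P\<close> encodes the interval from \<open>a\<close> to \<open>b\<close>; the definition is
  meant for an interval \<open>S\<close>.\<close>

definition abs_continuous_on :: "real set \<Rightarrow> (real \<Rightarrow> real) \<Rightarrow> bool" where
  "abs_continuous_on S f \<longleftrightarrow>
     (\<forall>\<epsilon>>0. \<exists>\<delta>>0. \<forall>P. finite P \<and> P \<subseteq> {(a, b). a \<in> S \<and> b \<in> S \<and> a < b} \<and>
        pairwise (\<lambda>p q. {fst p<..<snd p} \<inter> {fst q<..<snd q} = {}) P \<and>
        (\<Sum>(a, b)\<in>P. b - a) < \<delta> \<longrightarrow> (\<Sum>(a, b)\<in>P. \<bar>f b - f a\<bar>) < \<epsilon>)"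

text \<open>\<open>has_rl_derivative \<beta> \<rho> g\<close> says that the Riemann-Liouville derivative of order \<open>\<beta>\<close> of \<open>\<rho>\<close>
  exists on \<open>(0, \<infinity>)\<close> and equals \<open>g\<close> at every point of it. The point 0 is excluded from the
  absolute continuity: the fractional integral of order \<open>1 - \<beta>\<close> of \<open>t powr (\<beta> - 1)\<close> is the
  constant \<open>Gamma \<beta>\<close> on \<open>(0, \<infinity>)\<close>, whereas \<open>rl_integral\<close> always takes the value 0 at 0.\<close>

definition has_rl_derivative :: "real \<Rightarrow> (real \<Rightarrow> real) \<Rightarrow> (real \<Rightarrow> real) \<Rightarrow> bool" where
  "has_rl_derivative \<beta> \<rho> g \<longleftrightarrow>
     (\<forall>t>0. rl_integrable (1 - \<beta>) \<rho> t) \<and>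
     abs_continuous_on {0<..} (rl_integral (1 - \<beta>) \<rho>) \<and>
     (\<forall>t>0. (rl_integral (1 - \<beta>) \<rho> has_real_derivative g t) (at t))"

definition C_plus :: "real \<Rightarrow> (real \<Rightarrow> real) set" where
  "C_plus \<alpha> = {x. continuous_on {0<..} x \<and> (\<forall>t>0. 0 \<le> x t) \<and>
     (\<exists>y. continuous_on {0..} y \<and> (\<forall>t\<ge>0. 0 \<le> y t) \<and> (\<forall>t>0. y t = t powr \<alpha> * x t))}"

definition Lp_loc :: "real \<Rightarrow> (real \<Rightarrow> real) set" where
  "Lp_loc p = {f. \<forall>J. is_interval J \<and> bounded J \<and> J \<subseteq> {0..} \<longrightarrow>
     set_integrable lebesgue J (\<lambda>t. \<bar>f t\<bar> powr p)}"

text \<open>The power \<open>t\<^sup>\<mu>\<close> for \<open>t \<ge> 0\<close> with \<open>0\<^sup>0 = 1\<close>, in contrast to \<open>0 powr 0 = 0\<close>.\<close>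

definition rpow :: "real \<Rightarrow> real \<Rightarrow> real" where
  "rpow t \<mu> = (if \<mu> = 0 then 1 else t powr \<mu>)"

end

theory Submission
  imports Defs "HOL-Complex_Analysis.Great_Picard"
begin

text \<open>
  Put \<open>y t = t powr (1 - \<beta>) * x t\<close>. The initial value problem becomes the fixed point equation
  \<open>y t = x\<^sub>0 + \<integral> K t s * F s (y s) ds\<close> on \<open>[0, \<infinity>)\<close>, where
  \<open>K t s = t powr (1 - \<beta>) * (t - s) powr (\<beta> - 1) * s powr (\<beta> - 1)\<close> for \<open>0 < s < t\<close> and the
  growth bound on \<open>\<phi>\<close> gives \<open>0 \<le> F s u \<le> H s * (1 + u)\<close> with \<open>H\<close> locally in \<open>L\<^sup>p\<close>. The weights
  in the hypotheses are exactly those that make \<open>H\<close> a common bound for \<open>l\<close> and \<open>k\<close>.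

  Since \<open>p > 1 / \<beta>\<close>, the kernel \<open>K t\<close> lies in \<open>L\<^sup>q\<close> for the conjugate exponent \<open>q\<close>, and the
  \<open>q\<close>-th power of its norm is a power of \<open>t\<close> times a Beta value. Convergence of norms together with pointwise
  convergence yields that \<open>t \<mapsto> K t\<close> is continuous into \<open>L\<^sup>1(H ds)\<close>, down to \<open>t = 0\<close>
  (\<open>kernel_dist_tendsto\<close>). This one fact gives continuity of the integral operator,
  equicontinuity of everything in its range, and the smallness needed for a priori bounds.

  As \<open>\<phi>\<close> is only continuous, existence comes from compactness. Picard iteration with the argument
  delayed by \<open>d > 0\<close> becomes stationary on every bounded interval, so it produces exact solutions
  of the delayed equation. On bounded intervals the iterates are bounded and equicontinuous, uniformly in
  \<open>d\<close> (\<open>delayed_iterates_bounded\<close>, \<open>delayed_iterates_equicontinuous\<close>); along a subsequence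
  \<open>d \<rightarrow> 0\<close> they converge pointwise, and dominated convergence identifies the limit as a solution
  (\<open>volterra_solution_exists\<close>).

  In terms of \<open>x\<close> the equation reads \<open>x = x\<^sub>0 t powr (\<beta> - 1) + I\<^sup>\<beta> g\<close> with
  \<open>g = l * \<phi>(x) + k\<close>. Tonelli's theorem and the Beta integral turn the fractional integral of order
  \<open>1 - \<beta>\<close> of \<open>x\<close> into a constant plus the primitive of \<open>g\<close> (\<open>rl_integral_abel\<close>), which is
  differentiable because \<open>g\<close> is continuous and absolutely continuous because \<open>g\<close> is integrable
  near \<open>0\<close> and bounded on every \<open>[\<eta>, \<infinity>)\<close> with \<open>\<eta> > 0\<close>.

  For the limit, \<open>s powr (- \<gamma>)\<close> is small against \<open>s powr (- \<beta>)\<close> for large \<open>s\<close>, and Abel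
  integration maps \<open>s powr (- \<beta>)\<close> to a constant. Hence the nonlinear term contributes at most a
  constant plus half of the running maximum of \<open>x\<close>, so \<open>x\<close> is bounded (\<open>abel_solution_bounded\<close>). Then
  \<open>t powr \<beta> * g t\<close> tends to \<open>b\<close>, so \<open>x\<close> tends to
  \<open>b * Beta \<beta> (1 - \<beta>) / Gamma \<beta> = b * Gamma (1 - \<beta>)\<close> (\<open>abel_integral_tendsto\<close>), and the reflection
  formula rewrites this value.
\<close>

section \<open>Beta integrals and an elementary inequality\<close>

text \<open>The substitution \<open>s = c + (d - c) * t\<close> reduces this to the Beta integral over \<open>[0, 1]\<close>; each
  factor and the differential contribute their power of \<open>d - c\<close>.\<close>

lemma nn_integral_Beta_interval:
  fixes a b c d :: real
  assumes "a > 0" "b > 0" "c < d"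
  shows "(\<integral>\<^sup>+s. ennreal (indicator {c<..<d} s * ((d - s) powr (a - 1) * (s - c) powr (b - 1))) \<partial>lborel)
    = ennreal ((d - c) powr (a + b - 1) * Beta a b)"
proof -
  let ?f = "\<lambda>s. indicator {c<..<d} s * ((d - s) powr (a - 1) * (s - c) powr (b - 1))"
  let ?g = "\<lambda>t. indicator {0..1} t * (t powr (b - 1) * (1 - t) powr (a - 1))"
  have "(\<integral>\<^sup>+s. ennreal (?f s) \<partial>lborel)
      = ennreal \<bar>d - c\<bar> * (\<integral>\<^sup>+t. ennreal (?f (c + (d - c) * t)) \<partial>lborel)"
    using assms by (intro nn_integral_real_affine) auto
  also have "(\<lambda>t. ?f (c + (d - c) * t)) = (\<lambda>t. (d - c) powr (a + b - 2) * ?g t)"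
  proof
    fix t
    have mem: "c + (d - c) * t \<in> {c<..<d} \<longleftrightarrow> t \<in> {0<..<1}"
    proof -
      have "c < c + (d - c) * t \<longleftrightarrow> 0 < t" using assms by (simp add: zero_less_mult_iff)
      moreover have "c + (d - c) * t < d \<longleftrightarrow> (d - c) * t < (d - c) * 1"
        by (simp add: algebra_simps)
      moreover have "\<dots> \<longleftrightarrow> t < 1" using assms by (subst mult_less_cancel_left) simp
      ultimately show ?thesis by auto
    qed
    show "?f (c + (d - c) * t) = (d - c) powr (a + b - 2) * ?g t"
    proof (cases "t \<in> {0<..<1}")
      case True
      have "d - (c + (d - c) * t) = (d - c) * (1 - t)" by (simp add: algebra_simps)
      moreover have "((d - c) * (1 - t)) powr (a - 1) = (d - c) powr (a - 1) * (1 - t) powr (a - 1)"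
        by (rule powr_mult)
      moreover have "((d - c) * t) powr (b - 1) = (d - c) powr (b - 1) * t powr (b - 1)"
        by (rule powr_mult)
      moreover have "(d - c) powr (a - 1) * (d - c) powr (b - 1) = (d - c) powr (a + b - 2)"
        by (subst powr_add[symmetric]) (simp add: algebra_simps)
      moreover have "c + (d - c) * t - c = (d - c) * t" by simp
      ultimately show ?thesis using True mem
        by (simp add: mult_ac)
    next
      case False
      hence "t = 0 \<or> t = 1 \<or> t \<notin> {0..1}" by auto
      thus ?thesis using mem False by auto
    qed
  qed
  also have "(\<integral>\<^sup>+t. ennreal ((d - c) powr (a + b - 2) * ?g t) \<partial>lborel)
      = ennreal ((d - c) powr (a + b - 2)) * (\<integral>\<^sup>+t. ennreal (?g t) \<partial>lborel)"
    by (subst nn_integral_cmult[symmetric]) (auto simp: ennreal_mult')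
  also have "(\<integral>\<^sup>+t. ennreal (?g t) \<partial>lborel) = ennreal (Beta b a)"
    using has_integral_Beta_real[of b a] assms
    by (intro nn_integral_has_integral_lebesgue) auto
  also have "ennreal \<bar>d - c\<bar> * (ennreal ((d - c) powr (a + b - 2)) * ennreal (Beta b a))
      = ennreal ((d - c) powr (a + b - 1) * Beta a b)"
  proof -
    have "(d - c) powr (a + b - 1) = (d - c) powr (1 + (a + b - 2))" by (simp add: algebra_simps)
    also have "\<dots> = (d - c) * (d - c) powr (a + b - 2)"
      using assms by (subst powr_add) auto
    finally show ?thesis using assms
      by (simp add: ennreal_mult'[symmetric] ennreal_mult''[symmetric] Beta_commute mult_ac)
  qed
  finally show ?thesis .
qed

lemma
  fixes a b c d :: real
  assumes "a > 0" "b > 0" "c < d"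
  shows integrable_Beta_interval:
      "integrable lborel (\<lambda>s. indicator {c<..<d} s * ((d - s) powr (a - 1) * (s - c) powr (b - 1)))"
    and integral_Beta_interval:
      "(\<integral>s. indicator {c<..<d} s * ((d - s) powr (a - 1) * (s - c) powr (b - 1)) \<partial>lborel)
       = (d - c) powr (a + b - 1) * Beta a b"
proof -
  have B: "Beta a b \<ge> 0" using assms by (auto simp: Beta_def intro!: divide_nonneg_nonneg)
  have "has_bochner_integral lborel
      (\<lambda>s. indicator {c<..<d} s * ((d - s) powr (a - 1) * (s - c) powr (b - 1)))
      ((d - c) powr (a + b - 1) * Beta a b)"
    using nn_integral_Beta_interval[OF assms] B
    by (intro has_bochner_integral_nn_integral) (auto simp: indicator_def)
  thus "integrable lborel (\<lambda>s. indicator {c<..<d} s * ((d - s) powr (a - 1) * (s - c) powr (b - 1)))"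
    "(\<integral>s. indicator {c<..<d} s * ((d - s) powr (a - 1) * (s - c) powr (b - 1)) \<partial>lborel)
       = (d - c) powr (a + b - 1) * Beta a b"
    by (auto simp: has_bochner_integral_iff)
qed

text \<open>By homogeneity the larger number may be taken to be \<open>1\<close>; then \<open>u powr q \<le> u\<close> and
  \<open>(1 - u) powr q \<le> 1 - u\<close> add up to the claim. It makes \<open>L\<^sup>q\<close> convergence a consequence of
  \<open>L\<^sup>1\<close> convergence of the \<open>q\<close>-th powers.\<close>

lemma abs_diff_powr_le:
  fixes a b q :: real
  assumes "a \<ge> 0" "b \<ge> 0" "q \<ge> 1"
  shows "\<bar>a - b\<bar> powr q \<le> \<bar>a powr q - b powr q\<bar>"
proof -
  have *: "(a - b) powr q \<le> a powr q - b powr q" if "0 \<le> b" "b \<le> a" for a b :: real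
  proof (cases "a = 0")
    case False
    define u where "u = (a - b) / a"
    have a: "a > 0" using that False by auto
    have u: "0 \<le> u" "u \<le> 1" using that a by (auto simp: u_def)
    have ab: "a - b = a * u" "b = a * (1 - u)" using a by (auto simp: u_def field_simps)
    have "u powr q \<le> u powr 1" "(1 - u) powr q \<le> (1 - u) powr 1"
      using u assms(3) powr_mono'[of 1 q u] powr_mono'[of 1 q "1 - u"] by auto
    hence "u powr q + (1 - u) powr q \<le> 1" using u by auto
    hence "a powr q * (u powr q + (1 - u) powr q) \<le> a powr q" by (simp add: mult_left_le)
    moreover have "(a * u) powr q = a powr q * u powr q"
      by (rule powr_mult)
    moreover have "(a * (1 - u)) powr q = a powr q * (1 - u) powr q"
      by (rule powr_mult)
    ultimately have "(a * u) powr q + (a * (1 - u)) powr q \<le> a powr q" by (simp add: algebra_simps)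
    thus ?thesis unfolding ab(1)[symmetric] ab(2)[symmetric] by simp
  qed (use that in auto)
  show ?thesis
  proof (cases "b \<le> a")
    case True
    thus ?thesis using *[of b a] assms by auto
  next
    case False
    thus ?thesis using *[of a b] assms by (auto simp: abs_minus_commute)
  qed
qed

section \<open>The weighted Abel kernel\<close>

text \<open>The fractional integral of order \<open>\<beta>\<close>, conjugated by the weight \<open>t powr (1 - \<beta>)\<close> and without the
  factor \<open>1 / Gamma \<beta>\<close>. The indicator is part of the kernel so that all integrals run over the
  whole line and different values of \<open>t\<close> can be compared.\<close>

definition abel_kernel :: "real \<Rightarrow> real \<Rightarrow> real \<Rightarrow> real" where
  "abel_kernel \<beta> t s =
     indicator {0<..<t} s * (t powr (1 - \<beta>) * ((t - s) powr (\<beta> - 1) * s powr (\<beta> - 1)))"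

lemma abel_kernel_nonneg [simp]: "abel_kernel \<beta> t s \<ge> 0"
  by (simp add: abel_kernel_def)

lemma abel_kernel_measurable [measurable]: "abel_kernel \<beta> t \<in> borel_measurable borel"
  unfolding abel_kernel_def by measurable

lemma abel_kernel_eq_0: "s \<le> 0 \<or> t \<le> s \<Longrightarrow> abel_kernel \<beta> t s = 0"
  by (auto simp: abel_kernel_def)

text \<open>Both singularities of the \<open>q\<close>-th power have exponent \<open>q * (\<beta> - 1) > - 1\<close>. The value is a
  positive power of \<open>t\<close>, hence continuous in \<open>t\<close> up to and including \<open>t = 0\<close>.\<close>

lemma nn_integral_abel_kernel_powr:
  assumes "\<beta> < 1" "q > 0" "q * (1 - \<beta>) < 1" "t \<ge> 0"
  shows "(\<integral>\<^sup>+s. ennreal (abel_kernel \<beta> t s powr q) \<partial>lborel)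
     = ennreal (t powr (1 - q * (1 - \<beta>)) * Beta (1 - q * (1 - \<beta>)) (1 - q * (1 - \<beta>)))"
proof (cases "t = 0")
  case True
  thus ?thesis using assms by (simp add: abel_kernel_eq_0 abel_kernel_def)
next
  case False
  define r where "r = 1 - q * (1 - \<beta>)"
  have r: "r > 0" using assms by (simp add: r_def)
  have eq: "abel_kernel \<beta> t s powr q = t powr (q * (1 - \<beta>)) *
      (indicator {0<..<t} s * ((t - s) powr (r - 1) * (s - 0) powr (r - 1)))" for s
  proof (cases "s \<in> {0<..<t}")
    case True
    have e: "q * (\<beta> - 1) = r - 1" by (simp add: r_def algebra_simps)
    show ?thesis using True e assms
      by (simp add: abel_kernel_def powr_mult powr_powr mult.commute[of _ q])
  next
    case False
    thus ?thesis by (auto simp: abel_kernel_def)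
  qed
  have "(\<integral>\<^sup>+s. ennreal (abel_kernel \<beta> t s powr q) \<partial>lborel)
     = ennreal (t powr (q * (1 - \<beta>))) *
       (\<integral>\<^sup>+s. ennreal (indicator {0<..<t} s * ((t - s) powr (r - 1) * (s - 0) powr (r - 1))) \<partial>lborel)"
    unfolding eq by (subst nn_integral_cmult[symmetric]) (auto simp: ennreal_mult')
  also have "\<dots> = ennreal (t powr (q * (1 - \<beta>))) * ennreal ((t - 0) powr (r + r - 1) * Beta r r)"
    using False assms r by (subst nn_integral_Beta_interval) auto
  also have "\<dots> = ennreal (t powr r * Beta r r)"
  proof -
    have "t powr (q * (1 - \<beta>)) * t powr (r + r - 1) = t powr r"
      by (subst powr_add[symmetric]) (simp add: r_def algebra_simps)
    thus ?thesis by (simp add: ennreal_mult'[symmetric] mult.assoc[symmetric])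
  qed
  finally show ?thesis by (simp add: r_def)
qed

lemma tendsto_abel_kernel:
  assumes "X \<longlonglongrightarrow> t" "\<And>n. X n \<ge> 0" "s \<noteq> t"
  shows "(\<lambda>n. abel_kernel \<beta> (X n) s) \<longlonglongrightarrow> abel_kernel \<beta> t s"
proof (cases "s \<in> {0<..<t}")
  case True
  have "(\<lambda>n. X n powr (1 - \<beta>) * ((X n - s) powr (\<beta> - 1) * s powr (\<beta> - 1)))
      \<longlonglongrightarrow> t powr (1 - \<beta>) * ((t - s) powr (\<beta> - 1) * s powr (\<beta> - 1))"
    using True assms by (intro tendsto_intros) auto
  moreover have "eventually (\<lambda>n. X n > s) sequentially"
    using True assms(1) by (intro order_tendstoD) auto
  hence "eventually (\<lambda>n. X n powr (1 - \<beta>) * ((X n - s) powr (\<beta> - 1) * s powr (\<beta> - 1))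
      = abel_kernel \<beta> (X n) s) sequentially"
    by eventually_elim (use True in \<open>simp add: abel_kernel_def\<close>)
  ultimately show ?thesis
    using True by (auto simp: abel_kernel_def intro: Lim_transform_eventually)
next
  case False
  have "eventually (\<lambda>n. abel_kernel \<beta> (X n) s = 0) sequentially"
  proof (cases "s \<le> 0")
    case True
    thus ?thesis by (simp add: abel_kernel_eq_0)
  next
    case s: False
    hence "s > t" using False assms(3) by auto
    hence "eventually (\<lambda>n. X n < s) sequentially"
      using assms(1) by (intro order_tendstoD) auto
    thus ?thesis by eventually_elim (simp add: abel_kernel_eq_0)
  qed
  moreover have "abel_kernel \<beta> t s = 0" using False by (auto simp: abel_kernel_def)
  ultimately show ?thesis by (simp add: tendsto_eventually)
qed

text \<open>\<open>H\<close> is the density of the measure against which the kernel is integrated. The condition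
  \<open>p > 1 / \<beta>\<close> says that the conjugate exponent \<open>q\<close> satisfies \<open>q * (1 - \<beta>) < 1\<close>, so that Young's
  inequality pairs \<open>K t\<close> in \<open>L\<^sup>q\<close> with \<open>H\<close> in \<open>L\<^sup>p\<close>.\<close>

locale abel_weight =
  fixes \<beta> p :: real and H :: "real \<Rightarrow> real"
  assumes beta: "0 < \<beta>" "\<beta> < 1" and p: "p > 1 / \<beta>"
    and H_measurable [measurable]: "H \<in> borel_measurable borel"
    and H_nonneg [simp]: "\<And>s. H s \<ge> 0"
    and H_powr_integrable: "\<And>R. integrable lborel (\<lambda>s. indicator {0<..R} s * H s powr p)"
begin

abbreviation K where "K \<equiv> abel_kernel \<beta>"

definition q where "q = p / (p - 1)"

lemma p_gt_1: "p > 1"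
proof -
  have "1 / \<beta> > 1" using beta by simp
  thus ?thesis using p by linarith
qed

lemma q: "q > 1" "1 / q + 1 / p = 1" "q * (1 - \<beta>) < 1"
proof -
  show "q > 1" "1 / q + 1 / p = 1" using p_gt_1 by (auto simp: q_def field_simps)
  have "p * \<beta> > 1" using p beta by (simp add: field_simps)
  hence "p * (1 - \<beta>) < p - 1" by (simp add: algebra_simps)
  thus "q * (1 - \<beta>) < 1" using p_gt_1 by (simp add: q_def field_simps)
qed

lemma kernel_powr_integrable:
  assumes "t \<ge> 0"
  shows "integrable lborel (\<lambda>s. K t s powr q)"
  using nn_integral_abel_kernel_powr[of \<beta> q t] beta q assms
  by (intro integrableI_nn_integral_finite) auto

lemma kernel_times_weight_integrable:
  assumes "t \<ge> 0"
  shows "integrable lborel (\<lambda>s. K t s * H s)"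
proof (rule Bochner_Integration.integrable_bound)
  show "integrable lborel (\<lambda>s. K t s powr q / q + indicator {0<..t} s * H s powr p / p)"
    using kernel_powr_integrable[OF assms] H_powr_integrable[of t] by auto
  have "K t s * H s \<le> K t s powr q / q + indicator {0<..t} s * H s powr p / p" for s
  proof (cases "s \<in> {0<..<t}")
    case True
    thus ?thesis using Youngs_inequality[of q p "K t s" "H s"] q p_gt_1 by auto
  next
    case False
    hence "K t s = 0" by (auto intro: abel_kernel_eq_0)
    thus ?thesis using q p_gt_1 by (auto simp: indicator_def)
  qed
  thus "AE s in lborel. norm (K t s * H s)
      \<le> norm (K t s powr q / q + indicator {0<..t} s * H s powr p / p)"
    by (intro AE_I2) (smt (verit, best) H_nonneg abel_kernel_nonneg mult_nonneg_nonneg real_norm_def)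
qed auto

text \<open>The distance of two kernels in \<open>L\<^sup>1(H ds)\<close>.\<close>

definition kernel_dist where
  "kernel_dist t t' = (\<integral>s. \<bar>K t s - K t' s\<bar> * H s \<partial>lborel)"

lemma kernel_diff_integrable:
  assumes "t \<ge> 0" "t' \<ge> 0"
  shows "integrable lborel (\<lambda>s. \<bar>K t s - K t' s\<bar> * H s)"
proof -
  have "integrable lborel (\<lambda>s. \<bar>K t s * H s - K t' s * H s\<bar>)"
    using assms kernel_times_weight_integrable by auto
  also have "(\<lambda>s. \<bar>K t s * H s - K t' s * H s\<bar>) = (\<lambda>s. \<bar>K t s - K t' s\<bar> * H s)"
    by (simp add: abs_mult left_diff_distrib[symmetric])
  finally show ?thesis .
qed

lemma kernel_dist_nonneg: "kernel_dist t t' \<ge> 0"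
  unfolding kernel_dist_def by (intro integral_nonneg_AE) auto

text \<open>The \<open>q\<close>-th powers converge pointwise off the point \<open>t\<close>, and their integrals converge by the
  explicit formula, so Scheffe's lemma gives \<open>L\<^sup>1\<close> convergence of the \<open>q\<close>-th powers.\<close>

lemma kernel_powr_diff_tendsto:
  assumes X: "X \<longlonglongrightarrow> t" "\<And>n. X n \<ge> 0" and t: "t \<ge> 0"
  shows "(\<lambda>n. \<integral>s. \<bar>K (X n) s - K t s\<bar> powr q \<partial>lborel) \<longlonglongrightarrow> 0"
    and "\<And>n. integrable lborel (\<lambda>s. \<bar>K (X n) s - K t s\<bar> powr q)"
proof -
  have le: "\<bar>K (X n) s - K t s\<bar> powr q \<le> norm (K (X n) s powr q - K t s powr q)" for n s
    using abs_diff_powr_le[of "K (X n) s" "K t s" q] q by auto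
  show int: "integrable lborel (\<lambda>s. \<bar>K (X n) s - K t s\<bar> powr q)" for n
  proof (rule Bochner_Integration.integrable_bound)
    show "integrable lborel (\<lambda>s. norm (K (X n) s powr q - K t s powr q))"
      using kernel_powr_integrable[OF X(2)] kernel_powr_integrable[OF t] by auto
  qed (use le in auto)
  define r where "r = 1 - q * (1 - \<beta>)"
  have r: "r > 0" using q by (simp add: r_def)
  have nn: "(\<integral>\<^sup>+s. norm (K u s powr q) \<partial>lborel) = ennreal (u powr r * Beta r r)" if "u \<ge> 0" for u
    using nn_integral_abel_kernel_powr[of \<beta> q u] that beta q by (simp add: r_def)
  have "(\<lambda>n. ennreal (X n powr r * Beta r r)) \<longlonglongrightarrow> ennreal (t powr r * Beta r r)"
    using X r t by (intro tendsto_ennrealI tendsto_intros) auto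
  hence lim: "(\<lambda>n. \<integral>\<^sup>+s. norm (K (X n) s powr q) \<partial>lborel) \<longlonglongrightarrow> (\<integral>\<^sup>+s. norm (K t s powr q) \<partial>lborel)"
    using nn X(2) t by simp
  have S: "(\<lambda>n. \<integral>\<^sup>+s. norm (K (X n) s powr q - K t s powr q) \<partial>lborel) \<longlonglongrightarrow> 0"
  proof (rule Scheffe_lemma1)
    show "AE s in lborel. (\<lambda>n. K (X n) s powr q) \<longlonglongrightarrow> K t s powr q"
      using AE_lborel_singleton[of t]
    proof eventually_elim
      case (elim s)
      show ?case using tendsto_abel_kernel[OF X elim, of \<beta>] q
        by (intro tendsto_powr') auto
    qed
    show "limsup (\<lambda>n. \<integral>\<^sup>+s. norm (K (X n) s powr q) \<partial>lborel) \<le> (\<integral>\<^sup>+s. norm (K t s powr q) \<partial>lborel)"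
      using lim_imp_Limsup[OF _ lim] by simp
  qed (use kernel_powr_integrable X t in auto)
  have "(\<lambda>n. \<integral>\<^sup>+s. ennreal (\<bar>K (X n) s - K t s\<bar> powr q) \<partial>lborel) \<longlonglongrightarrow> 0"
  proof (rule tendsto_sandwich[OF _ _ tendsto_const S])
    show "\<forall>\<^sub>F n in sequentially. (\<integral>\<^sup>+s. ennreal (\<bar>K (X n) s - K t s\<bar> powr q) \<partial>lborel)
        \<le> (\<integral>\<^sup>+s. norm (K (X n) s powr q - K t s powr q) \<partial>lborel)"
      using le by (intro always_eventually allI nn_integral_mono ennreal_leI) auto
  qed auto
  moreover have "(\<integral>\<^sup>+s. ennreal (\<bar>K (X n) s - K t s\<bar> powr q) \<partial>lborel)
      = ennreal (\<integral>s. \<bar>K (X n) s - K t s\<bar> powr q \<partial>lborel)" for n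
    using int by (intro nn_integral_eq_integral) auto
  ultimately have "(\<lambda>n. ennreal (\<integral>s. \<bar>K (X n) s - K t s\<bar> powr q \<partial>lborel)) \<longlonglongrightarrow> ennreal 0"
    by simp
  thus "(\<lambda>n. \<integral>s. \<bar>K (X n) s - K t s\<bar> powr q \<partial>lborel) \<longlonglongrightarrow> 0"
    by (subst (asm) tendsto_ennreal_iff) (auto intro!: always_eventually integral_nonneg_AE)
qed

text \<open>Young's inequality with a free parameter \<open>c\<close> bounds the distance by
  \<open>c powr q\<close> times a null sequence plus \<open>c powr (- p)\<close> times a constant. Choosing \<open>c\<close> large first
  makes the second part small.\<close>

lemma kernel_dist_tendsto:
  assumes t: "t \<ge> 0"
  shows "((\<lambda>u. kernel_dist u t) \<longlongrightarrow> 0) (at t within {0..})"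
  unfolding tendsto_at_iff_sequentially
proof (intro allI impI)
  fix X assume X0: "\<forall>i. X i \<in> {0..} - {t}" and X1: "X \<longlonglongrightarrow> t"
  have X: "X n \<ge> 0" for n using X0 by auto
  obtain R where R: "\<And>n. X n \<le> R" "t \<le> R"
  proof -
    have "Bseq X" using X1 convergentI convergent_imp_Bseq by blast
    then obtain B where "\<And>n. norm (X n) \<le> B" unfolding Bseq_def by blast
    thus ?thesis using that[of "max B t"] by (metis abs_le_D1 max.coboundedI1 max.coboundedI2 order_refl real_norm_def)
  qed
  define P where "P = (\<integral>s. indicator {0<..R} s * H s powr p \<partial>lborel)"
  have P: "P \<ge> 0" unfolding P_def by (intro integral_nonneg_AE) auto
  define D where "D n = (\<integral>s. \<bar>K (X n) s - K t s\<bar> powr q \<partial>lborel)" for n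
  have D0: "D \<longlonglongrightarrow> 0" unfolding D_def using kernel_powr_diff_tendsto(1)[OF X1 X t] .
  have young: "kernel_dist (X n) t \<le> c powr q * D n + c powr (-p) * P" if c: "c > 0" for n c
  proof -
    have "kernel_dist (X n) t \<le> (\<integral>s. c powr q * \<bar>K (X n) s - K t s\<bar> powr q
        + c powr (-p) * (indicator {0<..R} s * H s powr p) \<partial>lborel)"
      unfolding kernel_dist_def
    proof (rule integral_mono)
      show "integrable lborel (\<lambda>s. \<bar>K (X n) s - K t s\<bar> * H s)"
        using X t by (intro kernel_diff_integrable) auto
      show "integrable lborel (\<lambda>s. c powr q * \<bar>K (X n) s - K t s\<bar> powr q
        + c powr (-p) * (indicator {0<..R} s * H s powr p))"
        using kernel_powr_diff_tendsto(2)[OF X1 X t, of n] H_powr_integrable[of R] by auto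
      fix s
      show "\<bar>K (X n) s - K t s\<bar> * H s \<le> c powr q * \<bar>K (X n) s - K t s\<bar> powr q
        + c powr (-p) * (indicator {0<..R} s * H s powr p)"
      proof (cases "s \<in> {0<..R}")
        case True
        let ?a = "\<bar>K (X n) s - K t s\<bar>"
        have "?a * H s = (c * ?a) * (H s / c)" using c by simp
        also have "\<dots> \<le> (c * ?a) powr q / q + (H s / c) powr p / p"
          using q p_gt_1 c by (intro Youngs_inequality) auto
        also have "\<dots> \<le> (c * ?a) powr q / 1 + (H s / c) powr p / 1"
          using q p_gt_1 by (intro add_mono divide_left_mono) auto
        also have "(c * ?a) powr q / 1 = c powr q * ?a powr q"
          using c by (simp add: powr_mult)
        also have "(H s / c) powr p / 1 = c powr (-p) * H s powr p"
          using c by (simp add: powr_divide powr_minus field_simps)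
        finally show ?thesis using True by simp
      next
        case False
        hence "s \<le> 0 \<or> X n \<le> s" "s \<le> 0 \<or> t \<le> s" using R(1)[of n] R(2) by auto
        hence "K (X n) s = 0" "K t s = 0" by (auto intro: abel_kernel_eq_0)
        thus ?thesis using False by simp
      qed
    qed
    also have "\<dots> = c powr q * D n + c powr (-p) * P"
      unfolding D_def P_def
      using kernel_powr_diff_tendsto(2)[OF X1 X t, of n] H_powr_integrable[of R] by simp
    finally show ?thesis .
  qed
  show "((\<lambda>u. kernel_dist u t) \<circ> X) \<longlonglongrightarrow> 0"
    unfolding o_def
  proof (rule LIMSEQ_I)
    fix e :: real assume e: "e > 0"
    \<comment> \<open>This \<open>c\<close> gives \<open>c powr (- p) = (e / 2) / (P + 1)\<close>; adding \<open>1\<close> covers \<open>P = 0\<close>.\<close>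
    define c where "c = ((P + 1) / (e / 2)) powr (1 / p)"
    have c: "c > 0" using P e by (simp add: c_def)
    have "c powr p = (P + 1) / (e / 2)"
      using P e p_gt_1 by (simp add: c_def powr_powr)
    hence "c powr (-p) * P = e / 2 * (P / (P + 1))" using e P c by (simp add: powr_minus divide_simps mult_ac)
    also have "\<dots> < e / 2 * 1" using P e by (intro mult_strict_left_mono) (auto simp: field_simps)
    finally have c1: "c powr (-p) * P < e / 2" by simp
    have "(\<lambda>n. c powr q * D n) \<longlonglongrightarrow> c powr q * 0" using D0 by (intro tendsto_intros)
    hence "eventually (\<lambda>n. c powr q * D n < e / 2) sequentially"
      using e by (intro order_tendstoD) auto
    hence "eventually (\<lambda>n. norm (kernel_dist (X n) t - 0) < e) sequentially"
    proof eventually_elim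
      case (elim n)
      show ?case using young[OF c, of n] c1 elim kernel_dist_nonneg[of "X n" t] by simp
    qed
    thus "\<exists>no. \<forall>n\<ge>no. norm (kernel_dist (X n) t - 0) < e"
      by (simp add: eventually_sequentially)
  qed
qed

text \<open>The distance of the kernels is a modulus of continuity common to all integrands dominated by a
  fixed multiple of \<open>H\<close>.\<close>

lemma
  assumes g [measurable]: "(\<lambda>s. indicator {0<..} s * g s) \<in> borel_measurable borel"
    and le: "\<And>s. 0 < s \<Longrightarrow> s < R \<Longrightarrow> \<bar>g s\<bar> \<le> C * H s" and C: "C \<ge> 0"
    and t: "0 \<le> t" "t \<le> R"
  shows kernel_times_integrable: "integrable lborel (\<lambda>s. K t s * g s)"
    and kernel_integral_diff_le: "0 \<le> t' \<Longrightarrow> t' \<le> R \<Longrightarrow>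
      \<bar>(\<integral>s. K t s * g s \<partial>lborel) - (\<integral>s. K t' s * g s \<partial>lborel)\<bar> \<le> C * kernel_dist t t'"
proof -
  have K_eq: "K u s * g s = K u s * (indicator {0<..} s * g s)" for u s
    by (auto simp: indicator_def abel_kernel_eq_0)
  have K_le: "\<bar>K u s * g s\<bar> \<le> C * (K u s * H s)" if "0 \<le> u" "u \<le> R" for u s
  proof (cases "0 < s \<and> s < u")
    case True
    thus ?thesis using that mult_left_mono[OF le[of s], of "K u s"] by (simp add: abs_mult mult_ac)
  next
    case False
    hence "K u s = 0" by (intro abel_kernel_eq_0) auto
    thus ?thesis by simp
  qed
  have int: "integrable lborel (\<lambda>s. K u s * g s)" if "0 \<le> u" "u \<le> R" for u
  proof (rule Bochner_Integration.integrable_bound)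
    show "integrable lborel (\<lambda>s. C * (K u s * H s))"
      using kernel_times_weight_integrable[of u] that by auto
    show "(\<lambda>s. K u s * g s) \<in> borel_measurable lborel"
      unfolding K_eq by measurable
  qed (use K_le[OF that] C in \<open>auto simp: abs_mult\<close>)
  show "integrable lborel (\<lambda>s. K t s * g s)" using int t by auto
  assume t': "0 \<le> t'" "t' \<le> R"
  have "\<bar>(\<integral>s. K t s * g s \<partial>lborel) - (\<integral>s. K t' s * g s \<partial>lborel)\<bar>
      = \<bar>\<integral>s. K t s * g s - K t' s * g s \<partial>lborel\<bar>"
    using int t t' by (subst Bochner_Integration.integral_diff) auto
  also have "\<dots> \<le> (\<integral>s. \<bar>K t s * g s - K t' s * g s\<bar> \<partial>lborel)"
    by (rule integral_abs_bound)
  also have "\<dots> \<le> (\<integral>s. C * (\<bar>K t s - K t' s\<bar> * H s) \<partial>lborel)"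
  proof (rule integral_mono)
    show "integrable lborel (\<lambda>s. \<bar>K t s * g s - K t' s * g s\<bar>)" using int t t' by auto
    show "integrable lborel (\<lambda>s. C * (\<bar>K t s - K t' s\<bar> * H s))"
      using kernel_diff_integrable t t' by auto
    fix s
    show "\<bar>K t s * g s - K t' s * g s\<bar> \<le> C * (\<bar>K t s - K t' s\<bar> * H s)"
    proof (cases "0 < s \<and> s < R")
      case True
      have "\<bar>K t s - K t' s\<bar> * \<bar>g s\<bar> \<le> \<bar>K t s - K t' s\<bar> * (C * H s)"
        using True by (intro mult_left_mono le) auto
      thus ?thesis by (simp add: abs_mult[symmetric] algebra_simps)
    next
      case False
      hence "K t s = 0" "K t' s = 0" using t t' by (auto intro!: abel_kernel_eq_0)
      thus ?thesis by simp
    qed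
  qed
  also have "\<dots> = C * kernel_dist t t'" by (simp add: kernel_dist_def)
  finally show "\<bar>(\<integral>s. K t s * g s \<partial>lborel) - (\<integral>s. K t' s * g s \<partial>lborel)\<bar> \<le> C * kernel_dist t t'" .
qed

text \<open>On a short interval ending near \<open>t\<close> the kernel has mass at most \<open>1 / 2\<close>, uniformly in its
  parameter \<open>u\<close>: first shrink the interval for the single kernel \<open>K t\<close>, then move from \<open>t\<close> to \<open>u\<close>
  at the cost of the kernel distance. This is what allows an a priori bound to be propagated past
  \<open>t\<close>.\<close>

lemma kernel_mass_tail_small:
  assumes t: "t \<ge> 0"
  shows "\<exists>\<delta>>0. \<forall>a u. t - \<delta> \<le> a \<longrightarrow> a \<le> t \<longrightarrow> 0 \<le> u \<longrightarrow> \<bar>u - t\<bar> < \<delta> \<longrightarrow>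
    (\<integral>s. K u s * (indicator {a<..} s * H s) \<partial>lborel) \<le> 1 / 2"
proof -
  have meas: "(\<lambda>s. indicator {0<..} s * (indicator {a<..} s * H s)) \<in> borel_measurable borel" for a :: real
    by measurable
  have int: "integrable lborel (\<lambda>s. K u s * (indicator {a<..} s * H s))" if "u \<ge> 0" for u a
    by (rule kernel_times_integrable[of _ u 1, OF meas]) (use that in \<open>auto simp: indicator_def\<close>)
  let ?I = "\<lambda>u a. \<integral>s. K u s * (indicator {a<..} s * H s) \<partial>lborel"
  have "(\<lambda>n. ?I t (t - 1 / real (Suc n))) \<longlonglongrightarrow> (\<integral>s. 0 \<partial>(lborel::real measure))"
  proof (rule integral_dominated_convergence[where w = "\<lambda>s. K t s * H s"])
    show "integrable lborel (\<lambda>s. K t s * H s)" using t by (rule kernel_times_weight_integrable)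
    show "AE s in lborel. (\<lambda>n. K t s * (indicator {t - 1 / real (Suc n)<..} s * H s)) \<longlonglongrightarrow> 0"
    proof (intro AE_I2)
      fix s
      show "(\<lambda>n. K t s * (indicator {t - 1 / real (Suc n)<..} s * H s)) \<longlonglongrightarrow> 0"
      proof (cases "s < t")
        case True
        have "(\<lambda>n. 1 / real (Suc n)) \<longlonglongrightarrow> 0" by (rule LIMSEQ_Suc) (rule lim_1_over_n)
        hence "eventually (\<lambda>n. 1 / real (Suc n) < t - s) sequentially"
          using True by (intro order_tendstoD) auto
        hence "eventually (\<lambda>n. K t s * (indicator {t - 1 / real (Suc n)<..} s * H s) = 0) sequentially"
          by eventually_elim auto
        thus ?thesis by (rule tendsto_eventually)
      next
        case False
        thus ?thesis by (simp add: abel_kernel_eq_0)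
      qed
    qed
  qed (auto simp: indicator_def)
  hence "eventually (\<lambda>n. ?I t (t - 1 / real (Suc n)) < 1 / 4) sequentially"
    by (intro order_tendstoD) auto
  then obtain n where n: "?I t (t - 1 / real (Suc n)) < 1 / 4"
    by (auto simp: eventually_sequentially)
  have "eventually (\<lambda>u. kernel_dist u t < 1 / 4) (at t within {0..})"
    using kernel_dist_tendsto[OF t] by (intro order_tendstoD) auto
  then obtain d where d: "d > 0" "\<And>u. u \<ge> 0 \<Longrightarrow> u \<noteq> t \<Longrightarrow> dist u t < d \<Longrightarrow> kernel_dist u t < 1 / 4"
    by (auto simp: eventually_at)
  have d': "kernel_dist u t < 1 / 4" if "u \<ge> 0" "\<bar>u - t\<bar> < d" for u
    using d(2)[of u] that by (cases "u = t") (auto simp: dist_real_def kernel_dist_def)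
  show ?thesis
  proof (intro exI[of _ "min d (1 / real (Suc n))"] conjI allI impI)
    show "min d (1 / real (Suc n)) > 0" using d by simp
    fix a u assume a: "t - min d (1 / real (Suc n)) \<le> a" "a \<le> t" and u: "0 \<le> u" "\<bar>u - t\<bar> < min d (1 / real (Suc n))"
    have "\<bar>?I u a - ?I t a\<bar> \<le> 1 * kernel_dist u t"
      by (rule kernel_integral_diff_le[of _ "max u t", OF meas])
        (use u t in \<open>auto simp: indicator_def\<close>)
    moreover have "?I t a \<le> ?I t (t - 1 / real (Suc n))"
      using a by (intro integral_mono int t mult_left_mono mult_right_mono) (auto simp: indicator_def)
    moreover have "kernel_dist u t < 1 / 4" using d' u by auto
    ultimately show "?I u a \<le> 1 / 2" using n by linarith
  qed
qed

lemma kernel_mass_bounded: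
  assumes "R \<ge> 0"
  shows "\<exists>G\<ge>0. \<forall>t\<in>{0..R}. (\<integral>s. K t s * H s \<partial>lborel) \<le> G"
proof -
  let ?I = "\<lambda>t. \<integral>s. K t s * H s \<partial>lborel"
  have "continuous_on {0..R} ?I"
    unfolding continuous_on_def
  proof
    fix t assume t: "t \<in> {0..R}"
    have "((\<lambda>u. ?I u - ?I t) \<longlongrightarrow> 0) (at t within {0..})"
    proof (rule Lim_null_comparison)
      show "\<forall>\<^sub>F u in at t within {0..}. norm (?I u - ?I t) \<le> kernel_dist u t"
        unfolding eventually_at_filter
      proof (intro always_eventually allI impI)
        fix u :: real assume "u \<in> {0..}"
        hence "\<bar>?I u - ?I t\<bar> \<le> 1 * kernel_dist u t"
          using t by (intro kernel_integral_diff_le[of _ "max u t"]) auto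
        thus "norm (?I u - ?I t) \<le> kernel_dist u t" by simp
      qed
    qed (use t in \<open>auto intro: kernel_dist_tendsto\<close>)
    hence "(?I \<longlongrightarrow> ?I t) (at t within {0..})" by (simp add: LIM_zero_iff)
    thus "(?I \<longlongrightarrow> ?I t) (at t within {0..R})" by (rule tendsto_within_subset) auto
  qed
  then obtain x where "x \<in> {0..R}" "\<And>t. t \<in> {0..R} \<Longrightarrow> ?I t \<le> ?I x"
    using continuous_attains_sup[of "{0..R}" ?I] assms by auto
  thus ?thesis by (intro exI[of _ "max 0 (?I x)"]) (auto simp: le_max_iff_disj)
qed

end

section \<open>Pointwise limits of equicontinuous sequences\<close>

text \<open>The diagonal subsequence that converges at all nonnegative rationals is Cauchy everywhere by
  equicontinuity. Dividing by \<open>1 + C t\<close> turns the pointwise bound into the uniform one that the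
  diagonal argument asks for.\<close>

lemma pointwise_convergent_subsequence:
  fixes f :: "nat \<Rightarrow> real \<Rightarrow> real"
  assumes bound: "\<And>n t. t \<ge> 0 \<Longrightarrow> \<bar>f n t\<bar> \<le> C t"
    and equi: "\<And>t e. t \<ge> 0 \<Longrightarrow> e > 0 \<Longrightarrow>
      \<exists>d>0. \<forall>u\<ge>0. \<bar>u - t\<bar> < d \<longrightarrow> (\<forall>n. \<bar>f n u - f n t\<bar> < e)"
  obtains k g where "strict_mono (k :: nat \<Rightarrow> nat)" "continuous_on {0..} g"
    "\<And>t. t \<ge> 0 \<Longrightarrow> (\<lambda>n. f (k n) t) \<longlonglongrightarrow> g t"
proof -
  let ?S = "\<rat> \<inter> {0..} :: real set"
  have C: "C t \<ge> 0" if "t \<ge> 0" for t using bound[OF that, of 0] by linarith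
  have "countable ?S" using countable_rat by auto
  moreover have "norm (f n t / (1 + C t)) \<le> 1" if "t \<in> ?S" for n t
    using bound[of t n] C[of t] that by (simp add: field_simps)
  ultimately obtain k where k: "strict_mono (k :: nat \<Rightarrow> nat)"
    and lim: "\<And>t. t \<in> ?S \<Longrightarrow> \<exists>l. (\<lambda>n. f (k n) t / (1 + C t)) \<longlonglongrightarrow> l"
    using function_convergent_subsequence[of ?S "\<lambda>n t. f n t / (1 + C t)" 1] by metis
  have Cauchy_rat: "Cauchy (\<lambda>n. f (k n) t)" if t: "t \<in> ?S" for t
  proof -
    obtain l where "(\<lambda>n. f (k n) t / (1 + C t)) \<longlonglongrightarrow> l" using lim[OF t] by blast
    hence "(\<lambda>n. f (k n) t / (1 + C t) * (1 + C t)) \<longlonglongrightarrow> l * (1 + C t)" by (rule tendsto_mult_right)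
    moreover have "1 + C t \<noteq> 0" using C[of t] t by auto
    ultimately have "(\<lambda>n. f (k n) t) \<longlonglongrightarrow> l * (1 + C t)" by simp
    thus ?thesis by (rule LIMSEQ_imp_Cauchy)
  qed
  have "convergent (\<lambda>n. f (k n) t)" if t: "t \<ge> 0" for t
  proof -
    have "Cauchy (\<lambda>n. f (k n) t)"
    proof (rule metric_CauchyI)
      fix e :: real assume e: "e > 0"
      obtain d where d: "d > 0" "\<And>u n. u \<ge> 0 \<Longrightarrow> \<bar>u - t\<bar> < d \<Longrightarrow> \<bar>f n u - f n t\<bar> < e / 3"
        using equi[OF t, of "e / 3"] e by auto
      obtain u where u: "u \<in> \<rat>" "t < u" "u < t + d"
        using Rats_dense_in_real[of t "t + d"] d by auto
      obtain N where N: "\<And>m n. m \<ge> N \<Longrightarrow> n \<ge> N \<Longrightarrow> dist (f (k m) u) (f (k n) u) < e / 3"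
        using metric_CauchyD[OF Cauchy_rat[of u], of "e / 3"] u t e by auto
      show "\<exists>M. \<forall>m\<ge>M. \<forall>n\<ge>M. dist (f (k m) t) (f (k n) t) < e"
      proof (intro exI[of _ N] allI impI)
        fix m n assume mn: "N \<le> m" "N \<le> n"
        have ut: "\<bar>f i u - f i t\<bar> < e / 3" for i using u t by (intro d) auto
        show "dist (f (k m) t) (f (k n) t) < e"
          using N[OF mn] ut[of "k m"] ut[of "k n"] unfolding dist_real_def by linarith
      qed
    qed
    thus ?thesis by (rule Cauchy_convergent)
  qed
  hence g: "(\<lambda>n. f (k n) t) \<longlonglongrightarrow> lim (\<lambda>n. f (k n) t)" if "t \<ge> 0" for t
    using that by (simp add: convergent_LIMSEQ_iff)
  define g where "g t = lim (\<lambda>n. f (k n) t)" for t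
  have "continuous_on {0..} g"
    unfolding continuous_on_iff
  proof (intro ballI allI impI)
    fix t e :: real assume t: "t \<in> {0..}" and e: "e > 0"
    then obtain d where d: "d > 0" "\<And>u n. u \<ge> 0 \<Longrightarrow> \<bar>u - t\<bar> < d \<Longrightarrow> \<bar>f n u - f n t\<bar> < e / 2"
      using equi[of t "e / 2"] by auto
    show "\<exists>d>0. \<forall>u\<in>{0..}. dist u t < d \<longrightarrow> dist (g u) (g t) < e"
    proof (intro exI[of _ d] conjI d ballI impI)
      fix u assume u: "u \<in> {0..}" "dist u t < d"
      have "(\<lambda>n. \<bar>f (k n) u - f (k n) t\<bar>) \<longlonglongrightarrow> \<bar>g u - g t\<bar>"
        unfolding g_def using u t by (intro tendsto_intros g) auto
      moreover have "\<bar>f (k n) u - f (k n) t\<bar> \<le> e / 2" for n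
        using d(2)[of u "k n"] u by (auto simp: dist_real_def)
      ultimately have "\<bar>g u - g t\<bar> \<le> e / 2" by (intro LIMSEQ_le_const2) auto
      thus "dist (g u) (g t) < e" using e by (simp add: dist_real_def)
    qed
  qed
  thus ?thesis using that[OF k, of g] g unfolding g_def by blast
qed

section \<open>Existence for the weighted Volterra equation\<close>

text \<open>In the application \<open>F s u\<close> is \<open>s powr (1 - \<beta>) / Gamma \<beta>\<close> times the right-hand side of the
  differential equation at \<open>x = s powr (\<beta> - 1) * u\<close>; the growth bound then holds with a weight
  \<open>H\<close> that is locally in \<open>L\<^sup>p\<close>.\<close>

locale abel_volterra = abel_weight +
  fixes F :: "real \<Rightarrow> real \<Rightarrow> real" and c :: real
  assumes F_cont: "continuous_on ({0<..} \<times> {0..}) (\<lambda>(s, u). F s u)"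
    and F_nonneg: "\<And>s u. s > 0 \<Longrightarrow> u \<ge> 0 \<Longrightarrow> F s u \<ge> 0"
    and F_le: "\<And>s u. s > 0 \<Longrightarrow> u \<ge> 0 \<Longrightarrow> F s u \<le> H s * (1 + u)"
    and c: "c \<ge> 0"
begin

definition admissible :: "(real \<Rightarrow> real) \<Rightarrow> bool" where
  "admissible y \<longleftrightarrow> continuous_on {0..} y \<and> (\<forall>t\<ge>0. 0 \<le> y t)"

definition volterra_op :: "(real \<Rightarrow> real) \<Rightarrow> real \<Rightarrow> real" where
  "volterra_op y t = c + (\<integral>s. K t s * F s (y s) \<partial>lborel)"

lemma continuous_on_F_comp:
  assumes "admissible y"
  shows "continuous_on {0<..} (\<lambda>s. F s (y s))"
proof -
  have y: "continuous_on {0..} y" "\<And>s. 0 \<le> s \<Longrightarrow> 0 \<le> y s"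
    using assms unfolding admissible_def by blast+
  have "continuous_on {0<..} y"
    by (rule continuous_on_subset[OF y(1)]) auto
  hence "continuous_on {0<..} (\<lambda>s. (s, y s))"
    by (rule continuous_on_Pair[OF continuous_on_id])
  moreover have "(\<lambda>s. (s, y s)) ` {0<..} \<subseteq> {0<..} \<times> {0..}"
    by (rule image_subsetI) (simp add: y(2))
  ultimately have "continuous_on {0<..} (\<lambda>s. (\<lambda>(s, u). F s u) (s, y s))"
    by (rule continuous_on_compose2[OF F_cont, of "{0<..}" "\<lambda>s. (s, y s)"])
  thus ?thesis by simp
qed

lemma F_comp_measurable:
  assumes "admissible y"
  shows "(\<lambda>s. indicator {0<..} s * F s (y s)) \<in> borel_measurable borel"
  using borel_measurable_continuous_on_indicator[OF _ continuous_on_F_comp[OF assms]] by simp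

lemma F_comp_le:
  assumes "admissible y" "\<And>s. 0 < s \<Longrightarrow> s < R \<Longrightarrow> y s \<le> C" "0 < s" "s < R"
  shows "\<bar>F s (y s)\<bar> \<le> (1 + C) * H s"
proof -
  have y: "y s \<ge> 0" using assms by (auto simp: admissible_def)
  have "F s (y s) \<le> H s * (1 + y s)" using F_le assms y by auto
  also have "\<dots> \<le> H s * (1 + C)" using assms by (intro mult_left_mono) auto
  finally show ?thesis using F_nonneg[of s "y s"] assms y by (simp add: mult.commute)
qed

lemma admissible_bounded:
  assumes "admissible y"
  obtains C where "C \<ge> 0" "\<And>s. 0 \<le> s \<Longrightarrow> s \<le> R \<Longrightarrow> y s \<le> C"
proof (cases "R \<ge> 0")
  case True
  have "continuous_on {0..R} y"
    by (rule continuous_on_subset[of "{0..}"]) (use assms in \<open>auto simp: admissible_def\<close>)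
  then obtain x where "x \<in> {0..R}" "\<And>t. t \<in> {0..R} \<Longrightarrow> y t \<le> y x"
    using continuous_attains_sup[of "{0..R}" y] True by auto
  thus ?thesis using assms that[of "y x"] by (auto simp: admissible_def)
next
  case False
  thus ?thesis using that[of 0] by auto
qed

lemma volterra_integrable:
  assumes "admissible y" "t \<ge> 0"
  shows "integrable lborel (\<lambda>s. K t s * F s (y s))"
proof -
  obtain C where "C \<ge> 0" "\<And>s. 0 \<le> s \<Longrightarrow> s \<le> t \<Longrightarrow> y s \<le> C" using admissible_bounded[OF assms(1), of t] by blast
  thus ?thesis using assms
    by (intro kernel_times_integrable[of _ t "1 + C"] F_comp_measurable F_comp_le) auto
qed

lemma volterra_op_diff_le:
  assumes "admissible y" "\<And>s. 0 \<le> s \<Longrightarrow> s < R \<Longrightarrow> y s \<le> C" "C \<ge> 0"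
    "0 \<le> t" "t \<le> R" "0 \<le> t'" "t' \<le> R"
  shows "\<bar>volterra_op y t - volterra_op y t'\<bar> \<le> (1 + C) * kernel_dist t t'"
proof -
  have "\<bar>(\<integral>s. K t s * F s (y s) \<partial>lborel) - (\<integral>s. K t' s * F s (y s) \<partial>lborel)\<bar>
      \<le> (1 + C) * kernel_dist t t'"
    using assms by (intro kernel_integral_diff_le[where R = R] F_comp_measurable F_comp_le) auto
  thus ?thesis by (simp add: volterra_op_def)
qed

lemma admissible_volterra_op:
  assumes "admissible y"
  shows "admissible (volterra_op y)"
  unfolding admissible_def
proof
  show "continuous_on {0..} (volterra_op y)"
    unfolding continuous_on_def
  proof
    fix t :: real assume t: "t \<in> {0..}"
    obtain C where C: "C \<ge> 0" "\<And>s. 0 \<le> s \<Longrightarrow> s \<le> t + 1 \<Longrightarrow> y s \<le> C"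
      using admissible_bounded[OF assms, of "t + 1"] by blast
    have "((\<lambda>u. volterra_op y u - volterra_op y t) \<longlongrightarrow> 0) (at t within {0..})"
    proof (rule Lim_null_comparison)
      have "eventually (\<lambda>u. u < t + 1) (nhds t)" by (intro order_tendstoD(2)[OF filterlim_ident]) auto
      thus "\<forall>\<^sub>F u in at t within {0..}. norm (volterra_op y u - volterra_op y t) \<le> (1 + C) * kernel_dist u t"
        unfolding eventually_at_filter
      proof eventually_elim
        case (elim u)
        show ?case using elim C t volterra_op_diff_le[OF assms, of "t + 1" C u t] by auto
      qed
      show "((\<lambda>u. (1 + C) * kernel_dist u t) \<longlongrightarrow> 0) (at t within {0..})"
        using t by (intro tendsto_mult_right_zero kernel_dist_tendsto) auto
    qed
    thus "(volterra_op y \<longlongrightarrow> volterra_op y t) (at t within {0..})" by (simp add: LIM_zero_iff)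
  qed
  have "0 \<le> K t s * F s (y s)" for t s
    using assms F_nonneg[of s "y s"] abel_kernel_eq_0[of s t \<beta>]
    by (cases "s > 0") (auto simp: admissible_def)
  thus "\<forall>t\<ge>0. 0 \<le> volterra_op y t"
    using c by (auto simp: volterra_op_def intro!: add_nonneg_nonneg integral_nonneg_AE)
qed

text \<open>Picard iteration for the equation whose right-hand side sees \<open>y\<close> only up to time \<open>s - d\<close>.\<close>

primrec delayed_iterate :: "real \<Rightarrow> nat \<Rightarrow> real \<Rightarrow> real" where
  "delayed_iterate d 0 = (\<lambda>_. c)"
| "delayed_iterate d (Suc j) = volterra_op (\<lambda>s. delayed_iterate d j (max 0 (s - d)))"

lemma admissible_delay:
  assumes "admissible y"
  shows "admissible (\<lambda>s. y (max 0 (s - d)))"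
proof -
  have y: "continuous_on {0..} y" "\<And>t. 0 \<le> t \<Longrightarrow> 0 \<le> y t"
    using assms unfolding admissible_def by blast+
  have "continuous_on {0..} (\<lambda>s. max 0 (s - d))" by (intro continuous_intros)
  moreover have "(\<lambda>s. max 0 (s - d)) ` {0..} \<subseteq> {0..}" by (rule image_subsetI) simp
  ultimately have "continuous_on {0..} (\<lambda>s. y (max 0 (s - d)))"
    by (rule continuous_on_compose2[OF y(1), of "{0..}" "\<lambda>s. max 0 (s - d)"])
  thus ?thesis unfolding admissible_def by (simp add: y(2))
qed

lemma admissible_delayed_iterate: "admissible (delayed_iterate d j)"
proof (induction j)
  case 0
  thus ?case using c by (simp add: admissible_def)
next
  case (Suc j)
  show ?case unfolding delayed_iterate.simps
    by (rule admissible_volterra_op, rule admissible_delay, rule Suc.IH)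
qed

lemma delayed_iterate_at_0: "delayed_iterate d j 0 = c"
  by (cases j) (auto simp: volterra_op_def abel_kernel_def)

text \<open>The values of an iterate up to time \<open>(j + 1) * d\<close> depend on those of its predecessor only up to
  time \<open>j * d\<close>, so each step settles a further interval of length \<open>d\<close>.\<close>

lemma delayed_iterate_stable:
  assumes "d > 0" "t \<le> real j * d"
  shows "delayed_iterate d (Suc j) t = delayed_iterate d j t"
  using assms(2)
proof (induction j arbitrary: t)
  case 0
  hence "K t s = 0" for s by (auto simp: abel_kernel_def)
  thus ?case by (simp add: volterra_op_def)
next
  case (Suc j)
  have "K t s * F s (delayed_iterate d (Suc j) (max 0 (s - d)))
      = K t s * F s (delayed_iterate d j (max 0 (s - d)))" for s
  proof (cases "s < t")
    case True
    hence "max 0 (s - d) \<le> real j * d" using Suc.prems assms(1) by (auto simp: algebra_simps)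
    from Suc.IH[OF this] show ?thesis by (simp only:)
  next
    case False
    thus ?thesis by (simp add: abel_kernel_eq_0)
  qed
  hence "volterra_op (\<lambda>s. delayed_iterate d (Suc j) (max 0 (s - d))) t
      = volterra_op (\<lambda>s. delayed_iterate d j (max 0 (s - d))) t"
    unfolding volterra_op_def by (simp only:)
  thus ?case by (simp only: delayed_iterate.simps)
qed

text \<open>Near a point \<open>t\<close>, a bound \<open>C\<close> up to a time \<open>a\<close> before \<open>t\<close> extends to a time \<open>b\<close> after \<open>t\<close>: the
  integral over \<open>(0, a]\<close> is controlled by \<open>C\<close>, and beyond \<open>a\<close> the kernel has mass at most
  \<open>1 / 2\<close>, so a bound \<open>B\<close> with \<open>A + (1 + B) / 2 \<le> B\<close> reproduces itself along the iteration.
  Bolzano's bisection principle chains the local extensions from \<open>0\<close> to \<open>R\<close>.\<close>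

lemma delayed_iterates_bounded:
  assumes "R \<ge> 0"
  shows "\<exists>C\<ge>0. \<forall>d\<ge>0. \<forall>j. \<forall>t\<in>{0..R}. delayed_iterate d j t \<le> C"
proof -
  define bdd where "bdd R \<longleftrightarrow> (\<exists>C\<ge>0. \<forall>d\<ge>0. \<forall>j. \<forall>t\<in>{0..R}. delayed_iterate d j t \<le> C)" for R
  have "0 \<le> (0::real) \<longrightarrow> bdd 0 \<longrightarrow> bdd R"
    using assms
  proof (induction rule: Bolzano[where P = "\<lambda>a b. 0 \<le> a \<longrightarrow> bdd a \<longrightarrow> bdd b"])
    case (trans a b c)
    thus ?case by auto
  next
    case (local t)
    obtain \<delta> where \<delta>: "\<delta> > 0" and small: "\<And>a u. t - \<delta> \<le> a \<Longrightarrow> a \<le> t \<Longrightarrow> 0 \<le> u \<Longrightarrow> \<bar>u - t\<bar> < \<delta> \<Longrightarrow>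
        (\<integral>s. K u s * (indicator {a<..} s * H s) \<partial>lborel) \<le> 1 / 2"
      using kernel_mass_tail_small local by metis
    show ?case
    proof (intro exI[of _ \<delta>] conjI allI impI \<delta>, elim conjE)
      fix a b assume ab: "a \<le> t" "t \<le> b" "b - a < \<delta>" "0 \<le> a" and "bdd a"
      then obtain C where C: "C \<ge> 0"
        "\<And>d j t. d \<ge> 0 \<Longrightarrow> 0 \<le> t \<Longrightarrow> t \<le> a \<Longrightarrow> delayed_iterate d j t \<le> C" unfolding bdd_def by auto
      obtain G where G: "G \<ge> 0" "\<And>t. 0 \<le> t \<Longrightarrow> t \<le> b \<Longrightarrow> (\<integral>s. K t s * H s \<partial>lborel) \<le> G"
        using kernel_mass_bounded[of b] ab by auto
      define A where "A = c + (1 + C) * G"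
      define B where "B = max C (2 * A + 1)"
      have A: "A \<ge> c" using C G by (simp add: A_def)
      have B: "B \<ge> C" "A + (1 + B) / 2 \<le> B" "B \<ge> c" "B \<ge> 0"
        using A c by (auto simp: B_def max_def field_simps)
      have "delayed_iterate d j u \<le> B" if d: "d \<ge> 0" and u: "0 \<le> u" "u \<le> b" for d j u
        using u
      proof (induction j arbitrary: u)
        case 0
        thus ?case using B by simp
      next
        case (Suc j u)
        show ?case
        proof (cases "u \<le> a")
          case True
          thus ?thesis using C(2)[OF d, of u "Suc j"] B Suc.prems by auto
        next
          case False
          let ?y = "\<lambda>s. delayed_iterate d j (max 0 (s - d))"
          have y: "admissible ?y" by (rule admissible_delay, rule admissible_delayed_iterate)
          have meas: "(\<lambda>s. indicator {0<..} s * (indicator {a<..} s * H s)) \<in> borel_measurable borel"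
            by measurable
          have int: "integrable lborel (\<lambda>s. K u s * (indicator {a<..} s * H s))"
            by (rule kernel_times_integrable[of _ u 1, OF meas]) (use Suc.prems in \<open>auto simp: indicator_def\<close>)
          have "(\<integral>s. K u s * F s (?y s) \<partial>lborel)
              \<le> (\<integral>s. (1 + C) * (K u s * H s) + (1 + B) * (K u s * (indicator {a<..} s * H s)) \<partial>lborel)"
          proof (rule integral_mono)
            show "integrable lborel (\<lambda>s. K u s * F s (?y s))"
              using volterra_integrable[OF y] Suc.prems by auto
            show "integrable lborel (\<lambda>s. (1 + C) * (K u s * H s) + (1 + B) * (K u s * (indicator {a<..} s * H s)))"
              using int kernel_times_weight_integrable Suc.prems by auto
            fix s
            show "K u s * F s (?y s) \<le> (1 + C) * (K u s * H s) + (1 + B) * (K u s * (indicator {a<..} s * H s))"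
            proof (cases "0 < s \<and> s < u")
              case True
              have "?y s \<ge> 0" using y True by (auto simp: admissible_def)
              hence "F s (?y s) \<le> H s * (1 + ?y s)" using F_le True by auto
              also have "\<dots> \<le> H s * ((1 + C) + (1 + B) * indicator {a<..} s)"
              proof (cases "s \<le> a")
                case sa: True
                have "?y s \<le> C" using True sa d ab by (intro C(2)) auto
                thus ?thesis using sa by (intro mult_left_mono) auto
              next
                case False
                have "?y s \<le> B" using True Suc.prems d by (intro Suc.IH) auto
                thus ?thesis using False C B by (intro mult_left_mono) auto
              qed
              finally have "K u s * F s (?y s) \<le> K u s * (H s * ((1 + C) + (1 + B) * indicator {a<..} s))"
                by (intro mult_left_mono) auto
              thus ?thesis by (simp add: algebra_simps)
            next
              case False
              hence "K u s = 0" by (intro abel_kernel_eq_0) auto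
              thus ?thesis by simp
            qed
          qed
          also have "\<dots> = (1 + C) * (\<integral>s. K u s * H s \<partial>lborel)
              + (1 + B) * (\<integral>s. K u s * (indicator {a<..} s * H s) \<partial>lborel)"
            using int kernel_times_weight_integrable[of u] Suc.prems by simp
          also have "\<dots> \<le> (1 + C) * G + (1 + B) * (1 / 2)"
          proof (intro add_mono mult_left_mono G(2) small)
            show "\<bar>u - t\<bar> < \<delta>" using ab False Suc.prems by auto
          qed (use ab Suc.prems C B in auto)
          finally show ?thesis using B(2) by (simp add: volterra_op_def A_def)
        qed
      qed
      thus "bdd b" unfolding bdd_def using B by auto
    qed
  qed
  moreover have "bdd 0"
    unfolding bdd_def using c by (intro exI[of _ c]) (auto simp: delayed_iterate_at_0)
  ultimately show ?thesis unfolding bdd_def by simp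
qed

lemma delayed_iterates_equicontinuous:
  assumes "d \<ge> 0" "\<And>j t. 0 \<le> t \<Longrightarrow> t \<le> R \<Longrightarrow> delayed_iterate d j t \<le> C" "C \<ge> 0"
    "0 \<le> t" "t \<le> R" "0 \<le> t'" "t' \<le> R"
  shows "\<bar>delayed_iterate d j t - delayed_iterate d j t'\<bar> \<le> (1 + C) * kernel_dist t t'"
proof (cases j)
  case 0
  thus ?thesis using assms kernel_dist_nonneg by simp
next
  case (Suc i)
  have bd: "delayed_iterate d i (max 0 (s - d)) \<le> C" if "0 \<le> s" "s < R" for s
    using that assms(1) by (intro assms(2)) auto
  have "admissible (\<lambda>s. delayed_iterate d i (max 0 (s - d)))"
    by (rule admissible_delay, rule admissible_delayed_iterate)
  thus ?thesis unfolding Suc delayed_iterate.simps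
    by (rule volterra_op_diff_le[where R = R]) (assumption | erule (1) bd | fact assms)+
qed

text \<open>With delay \<open>1 / (n + 1)\<close>, the iterate number \<open>(n + 1)\<^sup>2\<close> solves the delayed equation on
  \<open>[0, n + 1]\<close>. Equicontinuity makes the delayed and undelayed arguments have the same limit along
  a convergent subsequence.\<close>

theorem volterra_solution_exists:
  obtains y where "admissible y" "\<And>t. t \<ge> 0 \<Longrightarrow> y t = volterra_op y t"
proof -
  obtain C where C: "\<And>R. R \<ge> 0 \<Longrightarrow> C R \<ge> 0"
    "\<And>R d j t. R \<ge> 0 \<Longrightarrow> d \<ge> 0 \<Longrightarrow> 0 \<le> t \<Longrightarrow> t \<le> R \<Longrightarrow> delayed_iterate d j t \<le> C R"
    using delayed_iterates_bounded unfolding Ball_def atLeastAtMost_iff by metis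
  have it_nonneg: "delayed_iterate d j t \<ge> 0" if "t \<ge> 0" for d j t
    using admissible_delayed_iterate[of d j] that unfolding admissible_def by blast
  have equi: "\<exists>\<delta>>0. \<forall>u\<ge>0. \<bar>u - t\<bar> < \<delta> \<longrightarrow>
      (\<forall>d j. d \<ge> 0 \<longrightarrow> \<bar>delayed_iterate d j u - delayed_iterate d j t\<bar> < e)"
    if t: "t \<ge> 0" and e: "e > 0" for t e
  proof -
    have "((\<lambda>u. (1 + C (t + 1)) * kernel_dist u t) \<longlongrightarrow> 0) (at t within {0..})"
      using t by (intro tendsto_mult_right_zero kernel_dist_tendsto)
    hence "eventually (\<lambda>u. (1 + C (t + 1)) * kernel_dist u t < e) (at t within {0..})"
      using e by (rule order_tendstoD)
    then obtain \<delta> where \<delta>: "\<delta> > 0"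
      "\<And>u. u \<ge> 0 \<Longrightarrow> u \<noteq> t \<Longrightarrow> dist u t < \<delta> \<Longrightarrow> (1 + C (t + 1)) * kernel_dist u t < e"
      by (auto simp: eventually_at)
    show ?thesis
    proof (intro exI[of _ "min \<delta> 1"] conjI allI impI)
      show "min \<delta> 1 > 0" using \<delta> by simp
      fix u d :: real and j :: nat assume u: "u \<ge> 0" "\<bar>u - t\<bar> < min \<delta> 1" and d: "d \<ge> 0"
      show "\<bar>delayed_iterate d j u - delayed_iterate d j t\<bar> < e"
      proof (cases "u = t")
        case True
        thus ?thesis using e by simp
      next
        case False
        have t1: "t + 1 \<ge> 0" "u \<le> t + 1" "t \<le> t + 1" using u t by auto
        have "\<bar>delayed_iterate d j u - delayed_iterate d j t\<bar> \<le> (1 + C (t + 1)) * kernel_dist u t"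
          using d C(2)[OF t1(1) d] C(1)[OF t1(1)] u(1) t1(2) t t1(3)
          by (rule delayed_iterates_equicontinuous)
        also have "\<dots> < e" using u False by (intro \<delta>(2)) (auto simp: dist_real_def)
        finally show ?thesis .
      qed
    qed
  qed
  define d where "d n = 1 / real (Suc n)" for n
  define f where "f n = delayed_iterate (d n) (Suc n * Suc n)" for n
  have d0: "d n > 0" for n by (simp add: d_def)
  have f_nonneg: "f n t \<ge> 0" if "t \<ge> 0" for n t
    unfolding f_def by (rule it_nonneg[OF that])
  have f_bound: "\<bar>f n t\<bar> \<le> C t" if "t \<ge> 0" for n t
    using it_nonneg[OF that] C(2)[OF that less_imp_le[OF d0] that order_refl]
    unfolding f_def by (simp only: abs_of_nonneg)
  have f_equi: "\<exists>\<delta>>0. \<forall>u\<ge>0. \<bar>u - t\<bar> < \<delta> \<longrightarrow> (\<forall>n. \<bar>f n u - f n t\<bar> < e)"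
    if t: "t \<ge> 0" and e: "e > 0" for t e
    using equi[OF t e] d0 unfolding f_def by (meson less_imp_le)
  obtain k g where k: "strict_mono (k :: nat \<Rightarrow> nat)" and g_cont: "continuous_on {0..} g"
    and lim: "\<And>t. t \<ge> 0 \<Longrightarrow> (\<lambda>n. f (k n) t) \<longlonglongrightarrow> g t"
    using pointwise_convergent_subsequence[of f C, OF f_bound f_equi] by blast
  have "g t \<ge> 0" if "t \<ge> 0" for t
    using lim[OF that] f_nonneg[OF that] by (intro LIMSEQ_le_const) auto
  hence g: "admissible g" using g_cont unfolding admissible_def by blast
  have dk: "(\<lambda>n. d (k n)) \<longlonglongrightarrow> 0"
    using LIMSEQ_subseq_LIMSEQ[OF LIMSEQ_Suc[OF lim_1_over_n] k] by (simp add: d_def o_def)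
  have "g t = volterra_op g t" if t: "t \<ge> 0" for t
  proof -
    let ?y = "\<lambda>n s. f (k n) (max 0 (s - d (k n)))"
    have adm: "admissible (?y n)" for n
      unfolding f_def by (rule admissible_delay, rule admissible_delayed_iterate)
    have bd: "?y n s \<le> C t" if "0 < s" "s < t" for n s
      unfolding f_def using that t d0[of "k n"] by (intro C(2)) auto
    have "(\<lambda>n. \<integral>s. K t s * F s (?y n s) \<partial>lborel) \<longlonglongrightarrow> (\<integral>s. K t s * F s (g s) \<partial>lborel)"
    proof (rule integral_dominated_convergence[where w = "\<lambda>s. (1 + C t) * (K t s * H s)"])
      show "(\<lambda>s. K t s * F s (g s)) \<in> borel_measurable lborel"
        using volterra_integrable[OF g t] by (rule borel_measurable_integrable)
      show "(\<lambda>s. K t s * F s (?y n s)) \<in> borel_measurable lborel" for n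
        using volterra_integrable[OF adm t] by (rule borel_measurable_integrable)
      show "integrable lborel (\<lambda>s. (1 + C t) * (K t s * H s))"
        using kernel_times_weight_integrable[OF t] by (rule integrable_mult_right)
      show "AE s in lborel. (\<lambda>n. K t s * F s (?y n s)) \<longlonglongrightarrow> K t s * F s (g s)"
      proof (intro AE_I2)
        fix s
        show "(\<lambda>n. K t s * F s (?y n s)) \<longlonglongrightarrow> K t s * F s (g s)"
        proof (cases "s > 0")
          case s: True
          have "(\<lambda>n. ?y n s - f (k n) s) \<longlonglongrightarrow> 0"
          proof (rule LIMSEQ_I)
            fix e :: real assume e: "e > 0"
            obtain \<delta> where \<delta>: "\<delta> > 0" "\<And>u n. u \<ge> 0 \<Longrightarrow> \<bar>u - s\<bar> < \<delta> \<Longrightarrow> \<bar>f n u - f n s\<bar> < e"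
              using f_equi[of s e] s e by auto
            have "eventually (\<lambda>n. d (k n) < min \<delta> s) sequentially"
              using dk \<delta> s by (intro order_tendstoD) auto
            then obtain N where "\<And>n. n \<ge> N \<Longrightarrow> d (k n) < min \<delta> s"
              by (auto simp: eventually_sequentially)
            thus "\<exists>N. \<forall>n\<ge>N. norm (?y n s - f (k n) s - 0) < e"
              using s d0 by (intro exI[of _ N] allI impI) (force simp: less_imp_le intro!: \<delta>(2))
          qed
          hence "(\<lambda>n. (?y n s - f (k n) s) + f (k n) s) \<longlonglongrightarrow> 0 + g s"
            using lim s by (intro tendsto_add) auto
          hence ylim: "(\<lambda>n. ?y n s) \<longlonglongrightarrow> g s" by simp
          have ymem: "?y n s \<in> {0..}" for n
            using adm[of n] s unfolding admissible_def by auto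
          have "continuous_on {0..} (\<lambda>u. (\<lambda>(s, u). F s u) (s, u))"
          proof (rule continuous_on_compose2[OF F_cont])
            show "continuous_on {0..} (\<lambda>u. (s, u))" by (intro continuous_on_Pair continuous_on_const continuous_on_id)
            show "Pair s ` {0..} \<subseteq> {0<..} \<times> {0..}" using s by auto
          qed
          hence "continuous_on {0..} (F s)" by simp
          hence "(\<lambda>n. F s (?y n s)) \<longlonglongrightarrow> F s (g s)"
            using continuous_on_tendsto_compose[of "{0..}" "F s" "\<lambda>n. ?y n s" "g s" sequentially]
              ylim ymem g s unfolding admissible_def by auto
          thus ?thesis by (intro tendsto_mult tendsto_const)
        next
          case False
          hence "K t s = 0" by (intro abel_kernel_eq_0) auto
          thus ?thesis by simp
        qed
      qed
      show "AE s in lborel. norm (K t s * F s (?y n s)) \<le> (1 + C t) * (K t s * H s)" for n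
      proof (intro AE_I2)
        fix s
        show "norm (K t s * F s (?y n s)) \<le> (1 + C t) * (K t s * H s)"
        proof (cases "0 < s \<and> s < t")
          case True
          hence "\<bar>F s (?y n s)\<bar> \<le> (1 + C t) * H s" using F_comp_le[OF adm bd] by blast
          hence "K t s * \<bar>F s (?y n s)\<bar> \<le> K t s * ((1 + C t) * H s)" by (rule mult_left_mono) simp
          thus ?thesis by (simp add: abs_mult mult_ac)
        next
          case False
          hence "K t s = 0" by (intro abel_kernel_eq_0) auto
          thus ?thesis by simp
        qed
      qed
    qed
    hence "(\<lambda>n. volterra_op (?y n) t) \<longlonglongrightarrow> volterra_op g t"
      unfolding volterra_op_def by (intro tendsto_intros)
    moreover have "eventually (\<lambda>n. volterra_op (?y n) t = f (k n) t) sequentially"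
    proof -
      obtain N :: nat where N: "t \<le> real N" using real_arch_simple by blast
      show ?thesis
        unfolding eventually_sequentially
      proof (intro exI[of _ N] allI impI)
        fix n assume n: "N \<le> n"
        have "real (Suc (k n) * Suc (k n)) * d (k n) = real (Suc (k n))"
          by (simp add: d_def field_simps)
        moreover have "n \<le> k n" using k by (rule seq_suble)
        ultimately have "t \<le> real (Suc (k n) * Suc (k n)) * d (k n)" using N n by simp
        from delayed_iterate_stable[OF d0 this]
        show "volterra_op (?y n) t = f (k n) t"
          unfolding f_def delayed_iterate.simps(2) by (simp only:)
      qed
    qed
    ultimately have "(\<lambda>n. f (k n) t) \<longlonglongrightarrow> volterra_op g t"
      by (rule Lim_transform_eventually)
    thus ?thesis using lim[OF t] LIMSEQ_unique by blast
  qed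
  thus ?thesis using that g by blast
qed

end

section \<open>Abel integrals and primitives of their sources\<close>

text \<open>Up to the factor \<open>1 / Gamma \<beta>\<close> these are the integrand and the value of the fractional integral
  of order \<open>\<beta>\<close>, taken with respect to Lebesgue measure on the Borel sets.\<close>

definition abel_integrand :: "real \<Rightarrow> (real \<Rightarrow> real) \<Rightarrow> real \<Rightarrow> real \<Rightarrow> real" where
  "abel_integrand \<beta> g t s = indicator {0<..<t} s * ((t - s) powr (\<beta> - 1) * g s)"

definition abel_integral :: "real \<Rightarrow> (real \<Rightarrow> real) \<Rightarrow> real \<Rightarrow> real" where
  "abel_integral \<beta> g t = (\<integral>s. abel_integrand \<beta> g t s \<partial>lborel)"

lemma borel_measurable_indicator_times:
  fixes f :: "real \<Rightarrow> real"
  assumes "continuous_on {0<..} f" "S \<in> sets borel" "S \<subseteq> {0<..}"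
  shows "(\<lambda>s. indicator S s * f s) \<in> borel_measurable borel"
proof -
  have "continuous_on S f" using assms continuous_on_subset by blast
  from borel_measurable_continuous_on_indicator[OF assms(2) this] show ?thesis by simp
qed

locale abel_source =
  fixes \<beta> :: real and g :: "real \<Rightarrow> real"
  assumes beta: "0 < \<beta>" "\<beta> < 1"
    and g_cont: "continuous_on {0<..} g"
    and g_nonneg: "\<And>s. s > 0 \<Longrightarrow> g s \<ge> 0"
    and abel_integrable: "\<And>t. t > 0 \<Longrightarrow> integrable lborel (abel_integrand \<beta> g t)"
begin

lemma g_measurable [measurable]: "(\<lambda>s. indicator {0<..} s * g s) \<in> borel_measurable borel"
  using g_cont by (rule borel_measurable_indicator_times) auto

lemma g_measurable_Ioo:
  assumes "0 \<le> a"
  shows "(\<lambda>s. indicator {a<..<b} s * g s) \<in> borel_measurable borel"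
  using g_cont by (rule borel_measurable_indicator_times) (use assms in \<open>auto simp: subset_iff\<close>)

text \<open>Since \<open>\<beta> < 1\<close>, the factor \<open>(t - s) powr (\<beta> - 1)\<close> is at least \<open>t powr (\<beta> - 1)\<close>, so integrability
  against the Abel kernel already contains integrability near \<open>0\<close>.\<close>

lemma g_integrable: "integrable lborel (\<lambda>s. indicator {0<..<t} s * g s)"
proof (cases "t > 0")
  case True
  show ?thesis
  proof (rule Bochner_Integration.integrable_bound)
    show "integrable lborel (\<lambda>s. t powr (1 - \<beta>) * abel_integrand \<beta> g t s)"
      using abel_integrable[OF True] by (rule integrable_mult_right)
    show "(\<lambda>s. indicator {0<..<t} s * g s) \<in> borel_measurable lborel"
      using g_measurable_Ioo[of 0 t] by simp
    show "AE s in lborel. norm (indicator {0<..<t} s * g s)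
        \<le> norm (t powr (1 - \<beta>) * abel_integrand \<beta> g t s)"
    proof (intro AE_I2)
      fix s
      show "norm (indicator {0<..<t} s * g s) \<le> norm (t powr (1 - \<beta>) * abel_integrand \<beta> g t s)"
      proof (cases "s \<in> {0<..<t}")
        case s: True
        have "t powr (\<beta> - 1) \<le> (t - s) powr (\<beta> - 1)"
          using s beta by (intro powr_mono2') auto
        hence "t powr (1 - \<beta>) * t powr (\<beta> - 1) \<le> t powr (1 - \<beta>) * (t - s) powr (\<beta> - 1)"
          by (intro mult_left_mono) auto
        moreover have "t powr (1 - \<beta>) * t powr (\<beta> - 1) = 1"
          using True by (simp add: powr_add[symmetric])
        ultimately have "1 * g s \<le> t powr (1 - \<beta>) * (t - s) powr (\<beta> - 1) * g s"
          using s g_nonneg[of s] by (intro mult_right_mono) auto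
        thus ?thesis using s g_nonneg[of s] by (simp add: abel_integrand_def mult_ac)
      qed (simp add: abel_integrand_def)
    qed
  qed
qed simp

definition primitive :: "real \<Rightarrow> real" where
  "primitive t = (\<integral>s. indicator {0<..<t} s * g s \<partial>lborel)"

lemma primitive_diff:
  assumes "0 < a" "a \<le> b"
  shows "primitive b - primitive a = (\<integral>s. indicator {a<..<b} s * g s \<partial>lborel)"
proof -
  have "primitive b - primitive a = (\<integral>s. indicator {0<..<b} s * g s - indicator {0<..<a} s * g s \<partial>lborel)"
    unfolding primitive_def using g_integrable by (subst Bochner_Integration.integral_diff) auto
  also have "\<dots> = (\<integral>s. indicator {a<..<b} s * g s \<partial>lborel)"
  proof (rule integral_cong_AE)
    show "AE s in lborel. indicator {0<..<b} s * g s - indicator {0<..<a} s * g s = indicator {a<..<b} s * g s"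
      using AE_lborel_singleton[of a] by eventually_elim (use assms in \<open>auto simp: indicator_def\<close>)
    show "(\<lambda>s. indicator {0<..<b} s * g s - indicator {0<..<a} s * g s) \<in> borel_measurable lborel"
      using g_integrable by (intro borel_measurable_diff borel_measurable_integrable)
    show "(\<lambda>s. indicator {a<..<b} s * g s) \<in> borel_measurable lborel"
      using g_measurable_Ioo[of a b] assms by simp
  qed
  finally show ?thesis .
qed

text \<open>Away from \<open>0\<close> the primitive differs by a constant from a Henstock-Kurzweil integral over a
  compact interval, to which the fundamental theorem of calculus applies.\<close>

lemma primitive_has_derivative:
  assumes t: "t > 0"
  shows "(primitive has_real_derivative g t) (at t)"
proof -
  define a b where "a = t / 2" and "b = t + 1"
  have ab: "0 < a" "a < t" "t < b" using t by (auto simp: a_def b_def)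
  have cont: "continuous_on {a..b} g"
    by (rule continuous_on_subset[OF g_cont]) (use ab in auto)
  have eq: "primitive u = primitive a + integral {a..u} g" if "u \<in> {a<..<b}" for u
  proof -
    have "set_integrable lborel {a..u} g"
      by (rule borel_integrable_atLeastAtMost')
        (use continuous_on_subset[OF cont] that in auto)
    hence "(LINT s:{a..u}|lborel. g s) = integral {a..u} g"
      by (rule set_borel_integral_eq_integral)
    moreover have "(LINT s:{a..u}|lborel. g s) = (\<integral>s. indicator {a<..<u} s * g s \<partial>lborel)"
      unfolding set_lebesgue_integral_def
    proof (rule integral_cong_AE)
      show "AE s in lborel. indicator {a..u} s *\<^sub>R g s = indicator {a<..<u} s * g s"
        using AE_lborel_singleton[of a] AE_lborel_singleton[of u]
        by eventually_elim (auto simp: indicator_def)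
      show "(\<lambda>s. indicator {a..u} s *\<^sub>R g s) \<in> borel_measurable lborel"
        using borel_measurable_indicator_times[OF g_cont, of "{a..u}"] ab by (simp add: subset_iff)
      show "(\<lambda>s. indicator {a<..<u} s * g s) \<in> borel_measurable lborel"
        using g_measurable_Ioo[of a u] ab by simp
    qed
    ultimately show ?thesis using primitive_diff[of a u] ab that by auto
  qed
  have "((\<lambda>u. integral {a..u} g) has_real_derivative g t) (at t within {a..b})"
    using cont ab by (intro integral_has_real_derivative) auto
  hence "((\<lambda>u. integral {a..u} g) has_real_derivative g t) (at t)"
    using ab by (simp add: at_within_Icc_at)
  hence "((\<lambda>u. primitive a + integral {a..u} g) has_real_derivative g t) (at t)"
    using DERIV_add[OF DERIV_const] by fastforce
  thus ?thesis
  proof (rule has_field_derivative_transform_within_open)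
    show "open {a<..<b}" "t \<in> {a<..<b}" using ab by auto
  qed (use eq in auto)
qed

lemma primitive_tendsto_0: "(\<lambda>n. primitive (1 / real (Suc n))) \<longlonglongrightarrow> 0"
proof -
  have "(\<lambda>n. primitive (1 / real (Suc n))) \<longlonglongrightarrow> (\<integral>s. 0 \<partial>(lborel :: real measure))"
    unfolding primitive_def
  proof (rule integral_dominated_convergence[where w = "\<lambda>s. indicator {0<..<2} s * g s"])
    show "AE s in lborel. (\<lambda>n. indicator {0<..<1 / real (Suc n)} s * g s) \<longlonglongrightarrow> 0"
    proof (intro AE_I2)
      fix s :: real
      have "(\<lambda>n. 1 / real (Suc n)) \<longlonglongrightarrow> 0" by (rule LIMSEQ_Suc) (rule lim_1_over_n)
      hence "eventually (\<lambda>n. indicator {0<..<1 / real (Suc n)} s * g s = 0) sequentially"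
      proof (cases "s > 0")
        case True
        assume "(\<lambda>n. 1 / real (Suc n)) \<longlonglongrightarrow> 0"
        hence "eventually (\<lambda>n. 1 / real (Suc n) < s) sequentially"
          using True by (intro order_tendstoD)
        thus ?thesis by eventually_elim auto
      qed auto
      thus "(\<lambda>n. indicator {0<..<1 / real (Suc n)} s * g s) \<longlonglongrightarrow> 0"
        by (rule tendsto_eventually)
    qed
    show "AE s in lborel. norm (indicator {0<..<1 / real (Suc n)} s * g s)
        \<le> indicator {0<..<2} s * g s" for n
    proof (intro AE_I2)
      fix s :: real
      have "1 / real (Suc n) < 2" by (simp add: field_simps)
      thus "norm (indicator {0<..<1 / real (Suc n)} s * g s) \<le> indicator {0<..<2} s * g s"
        using g_nonneg[of s] by (auto simp: indicator_def)
    qed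
    show "(\<lambda>s. indicator {0<..<1 / real (Suc n)} s * g s) \<in> borel_measurable lborel" for n
      using g_integrable by (rule borel_measurable_integrable)
  qed (use g_integrable in auto)
  thus ?thesis by simp
qed

text \<open>Choose \<open>\<eta>\<close> with \<open>primitive \<eta> < e / 2\<close>. Disjoint intervals collect less than this from
  \<open>(0, \<eta>)\<close>, however many they are, and on \<open>[\<eta>, \<infinity>)\<close> the function \<open>g\<close> is bounded, which leaves a
  multiple of the total length.\<close>

lemma primitive_abs_continuous:
  assumes bdd: "\<And>s. s \<ge> 1 \<Longrightarrow> g s \<le> B"
  shows "abs_continuous_on {0<..} (\<lambda>t. c + primitive t)"
  unfolding abs_continuous_on_def
proof (intro allI impI)
  fix e :: real assume e: "e > 0"
  have "eventually (\<lambda>n. primitive (1 / real (Suc n)) < e / 2) sequentially"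
    using primitive_tendsto_0 e by (intro order_tendstoD) auto
  then obtain n where n: "primitive (1 / real (Suc n)) < e / 2"
    by (auto simp: eventually_sequentially)
  define \<eta> where "\<eta> = 1 / real (Suc n)"
  have \<eta>: "\<eta> > 0" "primitive \<eta> < e / 2" using n by (auto simp: \<eta>_def)
  obtain D where D: "D > 0" "\<And>s. s \<ge> \<eta> \<Longrightarrow> g s \<le> D"
  proof -
    have "continuous_on {\<eta>..max \<eta> 1} g"
      by (rule continuous_on_subset[OF g_cont]) (use \<eta> in auto)
    then obtain z where z: "\<And>s. s \<in> {\<eta>..max \<eta> 1} \<Longrightarrow> g s \<le> g z"
      using continuous_attains_sup[of "{\<eta>..max \<eta> 1}" g] by (metis atLeastAtMost_iff compact_Icc empty_iff max.cobounded1 order_refl)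
    show ?thesis
    proof (rule that[of "max 1 (max B (g z))"])
      fix s assume "s \<ge> \<eta>"
      thus "g s \<le> max 1 (max B (g z))"
        using bdd[of s] z[of s] by (cases "s \<ge> 1") (auto simp: le_max_iff_disj)
    qed auto
  qed
  show "\<exists>\<delta>>0. \<forall>P. finite P \<and> P \<subseteq> {(a, b). a \<in> {0<..} \<and> b \<in> {0<..} \<and> a < b} \<and>
        pairwise (\<lambda>p q. {fst p<..<snd p} \<inter> {fst q<..<snd q} = {}) P \<and>
        (\<Sum>(a, b)\<in>P. b - a) < \<delta> \<longrightarrow> (\<Sum>(a, b)\<in>P. \<bar>c + primitive b - (c + primitive a)\<bar>) < e"
  proof (intro exI[of _ "e / (2 * D)"] conjI allI impI)
    show "e / (2 * D) > 0" using e D by simp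
    fix P assume P: "finite P \<and> P \<subseteq> {(a, b). a \<in> {0<..} \<and> b \<in> {0<..} \<and> a < b} \<and>
        pairwise (\<lambda>p q. {fst p<..<snd p} \<inter> {fst q<..<snd q} = {}) P \<and>
        (\<Sum>(a, b)\<in>P. b - a) < e / (2 * D)"
    have fin: "finite P" and sub: "P \<subseteq> {(a, b). a \<in> {0<..} \<and> b \<in> {0<..} \<and> a < b}"
      using P by blast+
    have mem: "0 < fst p" "fst p < snd p" if "p \<in> P" for p
      using subsetD[OF sub that] by (auto simp: split_beta)
    have disj: "disjoint_family_on (\<lambda>p. {fst p<..<snd p}) P"
      using P by (auto simp: disjoint_family_on_def pairwise_def)
    let ?h = "\<lambda>s. indicator {0<..<\<eta>} s * g s"
    have int1: "integrable lborel (\<lambda>s. indicator {fst p<..<snd p} s * ?h s)" for p :: "real \<times> real"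
      using integrable_mult_indicator[OF _ g_integrable[of \<eta>], of "{fst p<..<snd p}"] by simp
    have incr: "\<bar>c + primitive (snd p) - (c + primitive (fst p))\<bar>
        \<le> (\<integral>s. indicator {fst p<..<snd p} s * ?h s \<partial>lborel) + D * (snd p - fst p)" if p: "p \<in> P" for p
    proof -
      have nn: "indicator {fst p<..<snd p} s * g s \<ge> 0" for s
        using mem[OF p] g_nonneg[of s] by (auto simp: indicator_def)
      have "c + primitive (snd p) - (c + primitive (fst p)) = (\<integral>s. indicator {fst p<..<snd p} s * g s \<partial>lborel)"
        using primitive_diff[of "fst p" "snd p"] mem[OF p] by simp
      moreover have "\<dots> \<ge> 0" using nn by (intro integral_nonneg_AE) auto
      moreover have "\<dots> \<le> (\<integral>s. indicator {fst p<..<snd p} s * ?h s + D * indicator {fst p<..<snd p} s \<partial>lborel)"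
      proof (rule integral_mono)
        show "integrable lborel (\<lambda>s. indicator {fst p<..<snd p} s * g s)"
        proof -
          have "(\<lambda>s. indicator {fst p<..<snd p} s * g s)
              = (\<lambda>s. indicator {fst p<..<snd p} s *\<^sub>R (indicator {0<..<snd p} s * g s))"
            using mem[OF p] by (auto simp: indicator_def)
          thus ?thesis
            using integrable_mult_indicator[OF _ g_integrable[of "snd p"], of "{fst p<..<snd p}"] by simp
        qed
        show "integrable lborel (\<lambda>s. indicator {fst p<..<snd p} s * ?h s + D * indicator {fst p<..<snd p} s)"
          using int1[of p] mem[OF p] by auto
        fix s
        show "indicator {fst p<..<snd p} s * g s
            \<le> indicator {fst p<..<snd p} s * ?h s + D * indicator {fst p<..<snd p} s"
          using mem[OF p] D(1) D(2)[of s] g_nonneg[of s] by (auto simp: indicator_def)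
      qed
      moreover have "\<dots> = (\<integral>s. indicator {fst p<..<snd p} s * ?h s \<partial>lborel) + D * (snd p - fst p)"
        using int1[of p] mem[OF p] by simp
      ultimately show ?thesis by linarith
    qed
    have "(\<Sum>(a, b)\<in>P. \<bar>c + primitive b - (c + primitive a)\<bar>)
        \<le> (\<Sum>p\<in>P. (\<integral>s. indicator {fst p<..<snd p} s * ?h s \<partial>lborel) + D * (snd p - fst p))"
      unfolding split_beta by (intro sum_mono incr)
    also have "\<dots> = (\<integral>s. (\<Sum>p\<in>P. indicator {fst p<..<snd p} s * ?h s) \<partial>lborel) + D * (\<Sum>(a, b)\<in>P. b - a)"
      using int1 by (simp add: sum.distrib sum_distrib_left split_beta)
    also have "(\<integral>s. (\<Sum>p\<in>P. indicator {fst p<..<snd p} s * ?h s) \<partial>lborel) \<le> primitive \<eta>"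
      unfolding primitive_def
    proof (rule integral_mono)
      show "integrable lborel (\<lambda>s. \<Sum>p\<in>P. indicator {fst p<..<snd p} s * ?h s)"
        using int1 by (intro Bochner_Integration.integrable_sum)
      fix s
      have "(\<Sum>p\<in>P. indicator {fst p<..<snd p} s * ?h s) = (\<Sum>p\<in>P. indicator {fst p<..<snd p} s) * ?h s"
        by (simp add: sum_distrib_right)
      also have "(\<Sum>p\<in>P. indicator {fst p<..<snd p} s :: real) = indicator (\<Union>p\<in>P. {fst p<..<snd p}) s"
        using indicator_UN_disjoint[OF fin disj] by metis
      also have "\<dots> * ?h s \<le> ?h s" using g_nonneg[of s] by (auto simp: indicator_def)
      finally show "(\<Sum>p\<in>P. indicator {fst p<..<snd p} s * ?h s) \<le> ?h s" .
    qed (rule g_integrable)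
    also have "D * (\<Sum>(a, b)\<in>P. b - a) < D * (e / (2 * D))"
      using P D by (intro mult_strict_left_mono) auto
    also have "D * (e / (2 * D)) = e / 2" using D by simp
    finally show "(\<Sum>(a, b)\<in>P. \<bar>c + primitive b - (c + primitive a)\<bar>) < e"
      using \<eta> by linarith
  qed
qed

end

section \<open>Behaviour of Abel integrals at infinity\<close>

text \<open>The exponents of the Beta integral add up to \<open>1\<close>, so the power of \<open>t\<close> disappears and the Abel
  integral of \<open>s powr (- \<beta>)\<close> is constant. This makes \<open>s powr (- \<beta>)\<close> the comparison function at
  infinity.\<close>

lemma abel_source_powr:
  assumes "0 < \<beta>" "\<beta> < 1"
  shows "abel_source \<beta> (\<lambda>s. s powr (- \<beta>))"
    and "t > 0 \<Longrightarrow> abel_integral \<beta> (\<lambda>s. s powr (- \<beta>)) t = Beta \<beta> (1 - \<beta>)"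
proof -
  have eq: "abel_integrand \<beta> (\<lambda>s. s powr (- \<beta>)) t
      = (\<lambda>s. indicator {0<..<t} s * ((t - s) powr (\<beta> - 1) * (s - 0) powr ((1 - \<beta>) - 1)))" for t
    by (simp add: abel_integrand_def fun_eq_iff)
  show "abel_source \<beta> (\<lambda>s. s powr (- \<beta>))"
  proof
    show "continuous_on {0<..} (\<lambda>s. s powr (- \<beta>))" by (intro continuous_intros) auto
    show "integrable lborel (abel_integrand \<beta> (\<lambda>s. s powr (- \<beta>)) t)" if "t > 0" for t
      unfolding eq using assms that by (intro integrable_Beta_interval) auto
  qed (use assms in auto)
  show "t > 0 \<Longrightarrow> abel_integral \<beta> (\<lambda>s. s powr (- \<beta>)) t = Beta \<beta> (1 - \<beta>)"
    unfolding eq abel_integral_def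
    using assms integral_Beta_interval[of \<beta> "1 - \<beta>" 0 t] by simp
qed

lemma Beta_pos: "a > 0 \<Longrightarrow> b > 0 \<Longrightarrow> Beta a (b :: real) > 0"
  by (auto simp: Beta_def intro!: divide_pos_pos mult_pos_pos)

text \<open>Beyond some \<open>T\<close> the function is dominated by \<open>\<eta> * s powr (- \<beta>)\<close>, which contributes at most
  \<open>\<eta> * Beta \<beta> (1 - \<beta>)\<close>; the part up to \<open>T\<close> is damped by \<open>(t - T) powr (\<beta> - 1)\<close>.\<close>

lemma abel_integral_tendsto_0:
  assumes beta: "0 < \<beta>" "\<beta> < 1"
    and int: "\<And>t. t > 0 \<Longrightarrow> integrable lborel (abel_integrand \<beta> e t)"
    and loc: "\<And>T. integrable lborel (\<lambda>s. indicator {0<..<T} s * e s)"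
    and lim: "((\<lambda>s. s powr \<beta> * e s) \<longlongrightarrow> 0) at_top"
  shows "(abel_integral \<beta> e \<longlongrightarrow> 0) at_top"
proof (rule tendstoI)
  fix \<epsilon> :: real assume \<epsilon>: "\<epsilon> > 0"
  interpret pw: abel_source \<beta> "\<lambda>s. s powr (- \<beta>)" using beta by (rule abel_source_powr)
  define B where "B = Beta \<beta> (1 - \<beta>)"
  have B: "B > 0" unfolding B_def using beta by (intro Beta_pos) auto
  define \<eta> where "\<eta> = \<epsilon> / (2 * B)"
  have \<eta>: "\<eta> > 0" "\<eta> * B = \<epsilon> / 2" using \<epsilon> B by (auto simp: \<eta>_def)
  have "eventually (\<lambda>s. \<bar>s powr \<beta> * e s\<bar> < \<eta>) at_top"
    using tendstoD[OF lim \<eta>(1)] by (simp add: dist_real_def)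
  then obtain T0 where T0: "\<And>s. s \<ge> T0 \<Longrightarrow> \<bar>s powr \<beta> * e s\<bar> < \<eta>"
    by (auto simp: eventually_at_top_linorder)
  define T where "T = max 1 T0"
  have T: "T \<ge> 1" "\<And>s. s \<ge> T \<Longrightarrow> \<bar>e s\<bar> \<le> \<eta> * s powr (- \<beta>)"
  proof -
    show "T \<ge> 1" by (simp add: T_def)
    fix s assume s: "s \<ge> T"
    hence s0: "s > 0" by (simp add: T_def)
    have "\<bar>s powr \<beta> * e s\<bar> \<le> \<eta>" using T0[of s] s by (simp add: T_def)
    hence "s powr (- \<beta>) * (s powr \<beta> * \<bar>e s\<bar>) \<le> s powr (- \<beta>) * \<eta>"
      by (intro mult_left_mono) (auto simp: abs_mult)
    moreover have "s powr (- \<beta>) * (s powr \<beta> * \<bar>e s\<bar>) = \<bar>e s\<bar>"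
      using s0 by (simp add: mult.assoc[symmetric] powr_add[symmetric])
    ultimately show "\<bar>e s\<bar> \<le> \<eta> * s powr (- \<beta>)" by (metis mult.commute)
  qed
  define E where "E = (\<integral>s. \<bar>indicator {0<..<T} s * e s\<bar> \<partial>lborel)"
  have "((\<lambda>t. (t - T) powr (\<beta> - 1) * E) \<longlongrightarrow> 0 * E) at_top"
  proof (intro tendsto_mult_right tendsto_neg_powr)
    show "filterlim (\<lambda>t. t - T) at_top at_top"
      using filterlim_tendsto_add_at_top[OF tendsto_const filterlim_ident, of "- T"] by simp
  qed (use beta in auto)
  hence "eventually (\<lambda>t. (t - T) powr (\<beta> - 1) * E < \<epsilon> / 2) at_top"
    using \<epsilon> by (intro order_tendstoD) auto
  moreover have "eventually (\<lambda>t. t > T) at_top" by (rule eventually_gt_at_top)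
  ultimately show "eventually (\<lambda>t. dist (abel_integral \<beta> e t) 0 < \<epsilon>) at_top"
  proof eventually_elim
    case (elim t)
    hence t: "t > 0" using T by simp
    have "\<bar>abel_integral \<beta> e t\<bar> \<le> (\<integral>s. \<bar>abel_integrand \<beta> e t s\<bar> \<partial>lborel)"
      unfolding abel_integral_def by (rule integral_abs_bound)
    also have "\<dots> \<le> (\<integral>s. (t - T) powr (\<beta> - 1) * \<bar>indicator {0<..<T} s * e s\<bar>
        + \<eta> * abel_integrand \<beta> (\<lambda>s. s powr (- \<beta>)) t s \<partial>lborel)"
    proof (rule integral_mono)
      show "integrable lborel (\<lambda>s. \<bar>abel_integrand \<beta> e t s\<bar>)" using int[OF t] by auto
      show "integrable lborel (\<lambda>s. (t - T) powr (\<beta> - 1) * \<bar>indicator {0<..<T} s * e s\<bar>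
        + \<eta> * abel_integrand \<beta> (\<lambda>s. s powr (- \<beta>)) t s)"
        using loc[of T] pw.abel_integrable[OF t]
        by (intro Bochner_Integration.integrable_add integrable_mult_right integrable_abs)
      fix s
      show "\<bar>abel_integrand \<beta> e t s\<bar> \<le> (t - T) powr (\<beta> - 1) * \<bar>indicator {0<..<T} s * e s\<bar>
        + \<eta> * abel_integrand \<beta> (\<lambda>s. s powr (- \<beta>)) t s"
      proof (cases "0 < s \<and> s < t")
        case True
        show ?thesis
        proof (cases "s < T")
          case sT: True
          have "(t - s) powr (\<beta> - 1) \<le> (t - T) powr (\<beta> - 1)"
            using sT elim beta by (intro powr_mono2') auto
          hence "(t - s) powr (\<beta> - 1) * \<bar>e s\<bar> \<le> (t - T) powr (\<beta> - 1) * \<bar>e s\<bar>"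
            by (intro mult_right_mono) auto
          moreover have "0 \<le> \<eta> * ((t - s) powr (\<beta> - 1) * s powr (- \<beta>))" using \<eta> by simp
          ultimately show ?thesis using True sT by (simp add: abel_integrand_def abs_mult)
        next
          case False
          have "(t - s) powr (\<beta> - 1) * \<bar>e s\<bar> \<le> (t - s) powr (\<beta> - 1) * (\<eta> * s powr (- \<beta>))"
            using T(2)[of s] False by (intro mult_left_mono) auto
          thus ?thesis using True False by (simp add: abel_integrand_def abs_mult mult_ac)
        qed
      qed (auto simp: abel_integrand_def)
    qed
    also have "\<dots> = (t - T) powr (\<beta> - 1) * E + \<eta> * B"
      using loc[of T] pw.abel_integrable[OF t] abel_source_powr(2)[OF beta t]
      by (simp add: E_def B_def abel_integral_def)
    finally show ?case using \<eta> elim by simp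
  qed
qed

context abel_source begin

lemma abel_integrand_nonneg: "abel_integrand \<beta> g t s \<ge> 0"
  using g_nonneg[of s] by (auto simp: abel_integrand_def indicator_def)

lemma abel_integral_nonneg: "abel_integral \<beta> g t \<ge> 0"
  unfolding abel_integral_def using abel_integrand_nonneg by (intro integral_nonneg_AE) auto

lemma abel_integral_tendsto:
  assumes "((\<lambda>s. s powr \<beta> * g s) \<longlongrightarrow> b) at_top"
  shows "(abel_integral \<beta> g \<longlongrightarrow> b * Beta \<beta> (1 - \<beta>)) at_top"
proof -
  interpret pw: abel_source \<beta> "\<lambda>s. s powr (- \<beta>)" using beta by (rule abel_source_powr)
  define e where "e s = g s - b * s powr (- \<beta>)" for s
  have eq: "abel_integrand \<beta> e t s = abel_integrand \<beta> g t s
      - b * abel_integrand \<beta> (\<lambda>s. s powr (- \<beta>)) t s" for t s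
    by (simp add: abel_integrand_def e_def algebra_simps)
  have "(abel_integral \<beta> e \<longlongrightarrow> 0) at_top"
  proof (rule abel_integral_tendsto_0[OF beta])
    show "integrable lborel (abel_integrand \<beta> e t)" if "t > 0" for t
      unfolding eq using abel_integrable[OF that] pw.abel_integrable[OF that] by auto
    have "(\<lambda>s. indicator {0<..<T} s * e s)
       = (\<lambda>s. indicator {0<..<T} s * g s - b * (indicator {0<..<T} s * s powr (- \<beta>)))" for T :: real
      by (simp add: e_def fun_eq_iff algebra_simps)
    thus "integrable lborel (\<lambda>s. indicator {0<..<T} s * e s)" for T
      using g_integrable[of T] pw.g_integrable[of T] by auto
    have "((\<lambda>s. s powr \<beta> * g s - b) \<longlongrightarrow> b - b) at_top" using assms by (intro tendsto_intros)
    hence lim: "((\<lambda>s. s powr \<beta> * g s - b) \<longlongrightarrow> 0) at_top" by simp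
    show "((\<lambda>s. s powr \<beta> * e s) \<longlongrightarrow> 0) at_top"
    proof (rule Lim_transform_eventually[OF lim])
      show "eventually (\<lambda>s. s powr \<beta> * g s - b = s powr \<beta> * e s) at_top"
        using eventually_gt_at_top[of 0]
      proof eventually_elim
        case (elim s)
        have "s powr \<beta> * s powr (- \<beta>) = 1" using elim by (simp add: powr_add[symmetric])
        thus ?case by (simp add: e_def algebra_simps)
      qed
    qed
  qed
  hence "((\<lambda>t. abel_integral \<beta> e t + b * Beta \<beta> (1 - \<beta>)) \<longlongrightarrow> 0 + b * Beta \<beta> (1 - \<beta>)) at_top"
    by (intro tendsto_intros)
  moreover have "eventually (\<lambda>t. abel_integral \<beta> e t + b * Beta \<beta> (1 - \<beta>) = abel_integral \<beta> g t) at_top"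
    using eventually_gt_at_top[of 0]
  proof eventually_elim
    case (elim t)
    have "abel_integral \<beta> e t = abel_integral \<beta> g t - b * abel_integral \<beta> (\<lambda>s. s powr (- \<beta>)) t"
      unfolding abel_integral_def eq using abel_integrable[OF elim] pw.abel_integrable[OF elim] by simp
    thus ?case using abel_source_powr(2)[OF beta elim] by simp
  qed
  ultimately show ?thesis using Lim_transform_eventually by fastforce
qed

lemma g_bounded:
  assumes "((\<lambda>s. s powr \<beta> * g s) \<longlongrightarrow> b) at_top"
  obtains B where "\<And>s. s \<ge> 1 \<Longrightarrow> g s \<le> B"
proof -
  have "eventually (\<lambda>s. s powr \<beta> * g s < b + 1) at_top"
    using assms by (rule order_tendstoD) simp
  then obtain T where T: "\<And>s. s \<ge> T \<Longrightarrow> s powr \<beta> * g s < b + 1"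
    by (auto simp: eventually_at_top_linorder)
  have "continuous_on {1..max 1 T} g"
    by (rule continuous_on_subset[OF g_cont]) auto
  then obtain z where z: "\<forall>s\<in>{1..max 1 T}. g s \<le> g z"
    using continuous_attains_sup[of "{1..max 1 T}" g] by auto
  have "g s \<le> max (g z) (b + 1)" if s: "s \<ge> 1" for s
  proof (cases "s \<le> T")
    case True
    thus ?thesis using z s by (auto simp: le_max_iff_disj)
  next
    case False
    have "s powr \<beta> \<ge> 1" using s beta by (simp add: ge_one_powr_ge_zero)
    hence "1 * g s \<le> s powr \<beta> * g s" using s g_nonneg[of s] by (intro mult_right_mono) auto
    thus ?thesis using T[of s] False by auto
  qed
  thus ?thesis using that by blast
qed

text \<open>Take \<open>T\<close> so large that \<open>a * K * T powr (\<beta> - \<gamma>) * Beta \<beta> (1 - \<beta>) \<le> 1 / 2\<close>. If \<open>u\<close> maximizes \<open>x\<close>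
  on \<open>[T, t]\<close> and \<open>u > T + 1\<close>, then the equation at \<open>u\<close> reads \<open>x u \<le> A + (1 + x u) / 2\<close> with \<open>A\<close>
  independent of \<open>t\<close>. The margin \<open>1\<close> keeps \<open>(u - s) powr (\<beta> - 1) \<le> 1\<close> for \<open>s < T\<close>; maximizers in
  \<open>[T, T + 1]\<close> are covered by compactness.\<close>

lemma abel_solution_bounded:
  assumes x_cont: "continuous_on {0<..} x" and x_nonneg: "\<And>t. t > 0 \<Longrightarrow> x t \<ge> 0"
    and x_eq: "\<And>t. t > 0 \<Longrightarrow> x t = c * t powr (\<beta> - 1) + a * abel_integral \<beta> g t"
    and ac: "a \<ge> 0" "c \<ge> 0" and gamma: "\<beta> < \<gamma>" and KD: "K \<ge> 0" "D \<ge> 0"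
    and growth: "eventually (\<lambda>s. g s \<le> K * s powr (- \<gamma>) * (1 + x s) + D * s powr (- \<beta>)) at_top"
  shows "\<exists>C. \<forall>t\<ge>1. x t \<le> C"
proof -
  interpret pw: abel_source \<beta> "\<lambda>s. s powr (- \<beta>)" using beta by (rule abel_source_powr)
  define B where "B = Beta \<beta> (1 - \<beta>)"
  have B: "B > 0" unfolding B_def using beta by (intro Beta_pos) auto
  have "((\<lambda>T. a * (K * T powr (\<beta> - \<gamma>)) * B) \<longlongrightarrow> a * (K * 0) * B) at_top"
    using gamma by (intro tendsto_intros tendsto_neg_powr filterlim_ident) auto
  hence "eventually (\<lambda>T. a * (K * T powr (\<beta> - \<gamma>)) * B < 1 / 2) at_top"
    by (intro order_tendstoD) auto
  hence "eventually (\<lambda>T. T \<ge> 1 \<and> a * (K * T powr (\<beta> - \<gamma>)) * B < 1 / 2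
      \<and> (\<forall>s\<ge>T. g s \<le> K * s powr (- \<gamma>) * (1 + x s) + D * s powr (- \<beta>))) at_top"
    using eventually_ge_at_top[of 1] eventually_all_ge_at_top[OF growth] by eventually_elim auto
  then obtain T where T: "T \<ge> 1" "a * (K * T powr (\<beta> - \<gamma>)) * B < 1 / 2"
    "\<And>s. s \<ge> T \<Longrightarrow> g s \<le> K * s powr (- \<gamma>) * (1 + x s) + D * s powr (- \<beta>)"
    by (auto simp: eventually_at_top_linorder)
  define \<kappa> where "\<kappa> = K * T powr (\<beta> - \<gamma>)"
  have \<kappa>: "\<kappa> \<ge> 0" "a * \<kappa> * B \<le> 1 / 2" using KD T by (auto simp: \<kappa>_def)
  have g_le: "g s \<le> (\<kappa> * (1 + m) + D) * s powr (- \<beta>)" if s: "s \<ge> T" and m: "x s \<le> m" for s m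
  proof -
    have s0: "s > 0" using s T by simp
    have "s powr (- \<gamma>) = s powr (\<beta> - \<gamma>) * s powr (- \<beta>)" by (simp add: powr_add[symmetric])
    also have "\<dots> \<le> T powr (\<beta> - \<gamma>) * s powr (- \<beta>)"
      using gamma s T by (intro mult_right_mono powr_mono2') auto
    finally have "K * s powr (- \<gamma>) * (1 + x s) \<le> K * (T powr (\<beta> - \<gamma>) * s powr (- \<beta>)) * (1 + m)"
      using KD x_nonneg[OF s0] m by (intro mult_mono mult_left_mono) auto
    thus ?thesis using T(3)[OF s] by (simp add: \<kappa>_def algebra_simps)
  qed
  define G where "G = (\<integral>s. indicator {0<..<T} s * g s \<partial>lborel)"
  have abel_le: "abel_integral \<beta> g t \<le> G + (\<kappa> * (1 + m) + D) * B"
    if t: "t \<ge> T + 1" and m: "\<And>s. T \<le> s \<Longrightarrow> s \<le> t \<Longrightarrow> x s \<le> m" for t m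
  proof -
    have t0: "t > 0" using t T by simp
    have m0: "m \<ge> 0" using m[of t] x_nonneg[OF t0] t by simp
    have "abel_integral \<beta> g t \<le> (\<integral>s. indicator {0<..<T} s * g s
        + (\<kappa> * (1 + m) + D) * abel_integrand \<beta> (\<lambda>s. s powr (- \<beta>)) t s \<partial>lborel)"
      unfolding abel_integral_def
    proof (rule integral_mono)
      show "integrable lborel (abel_integrand \<beta> g t)" using t0 by (rule abel_integrable)
      show "integrable lborel (\<lambda>s. indicator {0<..<T} s * g s
        + (\<kappa> * (1 + m) + D) * abel_integrand \<beta> (\<lambda>s. s powr (- \<beta>)) t s)"
        using g_integrable[of T] pw.abel_integrable[OF t0]
        by (intro Bochner_Integration.integrable_add integrable_mult_right)
      fix s
      show "abel_integrand \<beta> g t s \<le> indicator {0<..<T} s * g s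
        + (\<kappa> * (1 + m) + D) * abel_integrand \<beta> (\<lambda>s. s powr (- \<beta>)) t s"
      proof (cases "0 < s \<and> s < t")
        case True
        show ?thesis
        proof (cases "s < T")
          case sT: True
          have "(t - s) powr (\<beta> - 1) \<le> 1 powr (\<beta> - 1)"
            using sT t beta by (intro powr_mono2') auto
          hence "(t - s) powr (\<beta> - 1) * g s \<le> 1 * g s"
            using g_nonneg True by (intro mult_right_mono) auto
          moreover have "0 \<le> (\<kappa> * (1 + m) + D) * ((t - s) powr (\<beta> - 1) * s powr (- \<beta>))"
            using \<kappa> KD m0 by simp
          ultimately show ?thesis using True sT by (simp add: abel_integrand_def)
        next
          case False
          have "(t - s) powr (\<beta> - 1) * g s \<le> (t - s) powr (\<beta> - 1) * ((\<kappa> * (1 + m) + D) * s powr (- \<beta>))"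
            using False True m by (intro mult_left_mono g_le) auto
          thus ?thesis using True False by (simp add: abel_integrand_def mult_ac)
        qed
      next
        case False
        thus ?thesis using T g_nonneg[of s] by (auto simp: abel_integrand_def indicator_def)
      qed
    qed
    also have "\<dots> = G + (\<kappa> * (1 + m) + D) * B"
      using g_integrable[of T] pw.abel_integrable[OF t0] abel_source_powr(2)[OF beta t0]
      by (simp add: G_def B_def abel_integral_def)
    finally show ?thesis .
  qed
  have max_ex: "\<exists>u\<in>{v..w}. \<forall>s\<in>{v..w}. x s \<le> x u" if "0 < v" "v \<le> w" for v w
  proof -
    have "continuous_on {v..w} x"
      by (rule continuous_on_subset[OF x_cont]) (use that in auto)
    thus ?thesis using continuous_attains_sup[of "{v..w}" x] that by auto
  qed
  obtain u1 where "\<forall>s\<in>{1..T + 1}. x s \<le> x u1" using max_ex[of 1 "T + 1"] T(1) by auto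
  hence u1: "x s \<le> x u1" if "1 \<le> s" "s \<le> T + 1" for s using that by simp
  define A where "A = c + a * (G + D * B)"
  have "x t \<le> max (x u1) (2 * A + 1)" if t: "t \<ge> 1" for t
  proof (cases "t \<le> T + 1")
    case True
    thus ?thesis using u1[OF t] by simp
  next
    case False
    obtain u where u: "T \<le> u" "u \<le> t" and u_max: "\<And>s. T \<le> s \<Longrightarrow> s \<le> t \<Longrightarrow> x s \<le> x u"
      using max_ex[of T t] T False by auto
    have "x u \<le> max (x u1) (2 * A + 1)"
    proof (cases "u \<le> T + 1")
      case True
      thus ?thesis using u1[of u] u T by simp
    next
      case uT: False
      have u0: "u \<ge> 1" "u > 0" using u T by auto
      have "u powr (\<beta> - 1) \<le> 1 powr (\<beta> - 1)" using u0 beta by (intro powr_mono2') auto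
      hence "c * u powr (\<beta> - 1) \<le> c" using ac by (simp add: mult_left_le)
      moreover have "a * abel_integral \<beta> g u \<le> a * (G + (\<kappa> * (1 + x u) + D) * B)"
        using uT u u_max ac by (intro mult_left_mono abel_le) auto
      moreover have "a * (G + (\<kappa> * (1 + x u) + D) * B)
          = a * (G + D * B) + a * \<kappa> * B * (1 + x u)" by (simp add: algebra_simps)
      moreover have "a * \<kappa> * B * (1 + x u) \<le> 1 / 2 * (1 + x u)"
        using \<kappa> x_nonneg[OF u0(2)] by (intro mult_right_mono) auto
      ultimately have "x u \<le> A + 1 / 2 * (1 + x u)"
        using x_eq[OF u0(2)] unfolding A_def by linarith
      hence "x u \<le> 2 * A + 1" by (simp add: field_simps)
      thus ?thesis by simp
    qed
    moreover have "x t \<le> x u" using u_max[of t] False by simp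
    ultimately show ?thesis by linarith
  qed
  thus ?thesis by blast
qed

section \<open>The Riemann-Liouville derivative of an Abel integral\<close>

text \<open>By Tonelli's theorem, integrating \<open>(t - s) powr (- \<beta>) * (s - r) powr (\<beta> - 1)\<close> over \<open>r < s < t\<close>
  first gives the constant \<open>Beta (1 - \<beta>) \<beta> = Gamma (1 - \<beta>) * Gamma \<beta>\<close> for every \<open>r\<close>. The condition
  \<open>x 0 = 0\<close> lets the integrands over \<open>[0, t]\<close> and \<open>(0, t)\<close> agree everywhere.\<close>

lemma rl_integral_abel:
  assumes x_cont: "continuous_on {0<..} x" and x_0: "x 0 = 0" and c: "c \<ge> 0"
    and x_eq: "\<And>t. t > 0 \<Longrightarrow> x t = c * t powr (\<beta> - 1) + 1 / Gamma \<beta> * abel_integral \<beta> g t"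
    and t: "t > 0"
  shows "rl_integrable (1 - \<beta>) x t"
    and "rl_integral (1 - \<beta>) x t = c * Gamma \<beta> + primitive t"
proof -
  define f where "f s = indicator {0<..<t} s * ((t - s) powr (- \<beta>) * x s)" for s
  define B where "B = Beta (1 - \<beta>) \<beta>"
  have Gpos: "Gamma \<beta> > 0" "Gamma (1 - \<beta>) > 0" using beta by auto
  have B: "B = Gamma (1 - \<beta>) * Gamma \<beta>" by (simp add: B_def Beta_def)
  have B0: "B > 0" using Gpos by (simp add: B)
  \<comment> \<open>The indicator on \<open>g r\<close> repeats \<open>0 < r\<close> and makes \<open>h\<close> visibly Borel measurable.\<close>
  define h where "h s r = (if 0 < r \<and> r < s \<and> s < t
      then (t - s) powr (- \<beta>) * (s - r) powr (\<beta> - 1) * (indicator {0<..} r * g r) else 0)" for s r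
  have h_meas: "(\<lambda>(s, r). ennreal (h s r)) \<in> borel_measurable (lborel \<Otimes>\<^sub>M lborel)"
    unfolding h_def by measurable
  have f_meas: "f \<in> borel_measurable borel"
  proof -
    have "continuous_on {0<..<t} x" by (rule continuous_on_subset[OF x_cont]) auto
    hence "continuous_on {0<..<t} (\<lambda>s. (t - s) powr (- \<beta>) * x s)"
      by (intro continuous_intros) auto
    from borel_measurable_continuous_on_indicator[OF _ this] show ?thesis by (simp add: f_def[abs_def])
  qed
  have h_r: "(\<integral>\<^sup>+r. ennreal (h s r) \<partial>lborel) = ennreal (indicator {0<..<t} s * (t - s) powr (- \<beta>) * abel_integral \<beta> g s)" for s
  proof (cases "0 < s \<and> s < t")
    case True
    have "h s r = (t - s) powr (- \<beta>) * abel_integrand \<beta> g s r" for r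
      using True by (auto simp: h_def abel_integrand_def)
    hence "(\<integral>\<^sup>+r. ennreal (h s r) \<partial>lborel)
        = (\<integral>\<^sup>+r. ennreal ((t - s) powr (- \<beta>) * abel_integrand \<beta> g s r) \<partial>lborel)" by simp
    also have "\<dots> = ennreal (\<integral>r. (t - s) powr (- \<beta>) * abel_integrand \<beta> g s r \<partial>lborel)"
      using abel_integrable[of s] True abel_integrand_nonneg
      by (intro nn_integral_eq_integral integrable_mult_right) auto
    finally show ?thesis using True by (simp add: abel_integral_def)
  next
    case False
    hence "h s r = 0" for r by (auto simp: h_def)
    thus ?thesis using False by auto
  qed
  have h_s: "(\<integral>\<^sup>+s. ennreal (h s r) \<partial>lborel) = ennreal (B * (indicator {0<..<t} r * g r))" for r
  proof (cases "0 < r \<and> r < t")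
    case True
    have "h s r = g r * (indicator {r<..<t} s * ((t - s) powr ((1 - \<beta>) - 1) * (s - r) powr (\<beta> - 1)))" for s
      using True by (auto simp: h_def)
    hence "(\<integral>\<^sup>+s. ennreal (h s r) \<partial>lborel)
        = ennreal (g r) * (\<integral>\<^sup>+s. ennreal (indicator {r<..<t} s * ((t - s) powr ((1 - \<beta>) - 1) * (s - r) powr (\<beta> - 1))) \<partial>lborel)"
      using g_nonneg[of r] True by (simp add: ennreal_mult' nn_integral_cmult)
    also have "\<dots> = ennreal (g r) * ennreal ((t - r) powr ((1 - \<beta>) + \<beta> - 1) * B)"
      unfolding B_def using beta True by (subst nn_integral_Beta_interval) auto
    also have "\<dots> = ennreal (B * (indicator {0<..<t} r * g r))"
      using True g_nonneg[of r] B0 by (simp add: ennreal_mult'[symmetric] mult.commute)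
    finally show ?thesis .
  next
    case False
    hence "h s r = 0" for s by (auto simp: h_def)
    thus ?thesis using False by auto
  qed
  have "(\<integral>\<^sup>+s. ennreal (indicator {0<..<t} s * (t - s) powr (- \<beta>) * abel_integral \<beta> g s) \<partial>lborel)
      = (\<integral>\<^sup>+r. (\<integral>\<^sup>+s. ennreal (h s r) \<partial>lborel) \<partial>lborel)"
    using lborel_pair.Fubini'[OF h_meas] by (simp add: h_r)
  also have "\<dots> = ennreal (B * primitive t)"
  proof -
    have "(\<integral>\<^sup>+r. ennreal (B * (indicator {0<..<t} r * g r)) \<partial>lborel)
        = ennreal (\<integral>r. B * (indicator {0<..<t} r * g r) \<partial>lborel)"
      using g_integrable[of t] g_nonneg B0
      by (intro nn_integral_eq_integral integrable_mult_right) (auto simp: indicator_def)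
    thus ?thesis by (simp add: h_s primitive_def)
  qed
  finally have convolution:
    "(\<integral>\<^sup>+s. ennreal (indicator {0<..<t} s * (t - s) powr (- \<beta>) * abel_integral \<beta> g s) \<partial>lborel) = ennreal (B * primitive t)" .
  have prim0: "primitive t \<ge> 0"
    unfolding primitive_def using g_nonneg by (intro integral_nonneg_AE) (auto simp: indicator_def)
  have f_split: "f s = c * (indicator {0<..<t} s * ((t - s) powr ((1 - \<beta>) - 1) * (s - 0) powr (\<beta> - 1)))
      + 1 / Gamma \<beta> * (indicator {0<..<t} s * (t - s) powr (- \<beta>) * abel_integral \<beta> g s)" for s
    using x_eq[of s] by (auto simp: f_def indicator_def algebra_simps)
  have conv_meas: "(\<lambda>s. indicator {0<..<t} s * (t - s) powr (- \<beta>) * abel_integral \<beta> g s) \<in> borel_measurable borel"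
  proof -
    have "(\<lambda>s. indicator {0<..<t} s * (t - s) powr (- \<beta>) * abel_integral \<beta> g s)
      = (\<lambda>s. Gamma \<beta> * (f s - c * (indicator {0<..<t} s * ((t - s) powr ((1 - \<beta>) - 1) * (s - 0) powr (\<beta> - 1)))))"
      using Gpos by (simp add: f_split fun_eq_iff)
    thus ?thesis using f_meas by simp
  qed
  have "has_bochner_integral lborel (\<lambda>s. indicator {0<..<t} s * (t - s) powr (- \<beta>) * abel_integral \<beta> g s) (B * primitive t)"
    using conv_meas convolution B0 prim0 abel_integral_nonneg
    by (intro has_bochner_integral_nn_integral) auto
  moreover have "has_bochner_integral lborel
      (\<lambda>s. indicator {0<..<t} s * ((t - s) powr ((1 - \<beta>) - 1) * (s - 0) powr (\<beta> - 1))) B"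
    using integrable_Beta_interval[of "1 - \<beta>" \<beta> 0 t] integral_Beta_interval[of "1 - \<beta>" \<beta> 0 t] beta t
    by (simp add: has_bochner_integral_iff B_def)
  ultimately have "has_bochner_integral lborel f (c * B + 1 / Gamma \<beta> * (B * primitive t))"
    unfolding f_split[abs_def]
    by (intro has_bochner_integral_add has_bochner_integral_mult_right)
  also have "c * B + 1 / Gamma \<beta> * (B * primitive t) = Gamma (1 - \<beta>) * (c * Gamma \<beta> + primitive t)"
    using Gpos by (simp add: B field_simps)
  finally have hb: "has_bochner_integral lborel f (Gamma (1 - \<beta>) * (c * Gamma \<beta> + primitive t))" .
  have eq: "(\<lambda>s. indicator {0..t} s *\<^sub>R ((t - s) powr (1 - \<beta> - 1) * x s)) = f"
    using x_0 by (auto simp: f_def indicator_def fun_eq_iff)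
  show "rl_integrable (1 - \<beta>) x t"
    unfolding rl_integrable_def set_integrable_def eq
    using hb f_meas by (simp add: integrable_completion has_bochner_integral_iff)
  show "rl_integral (1 - \<beta>) x t = c * Gamma \<beta> + primitive t"
    unfolding rl_integral_def set_lebesgue_integral_def eq
    using hb f_meas Gpos by (simp add: integral_completion has_bochner_integral_iff)
qed

lemma has_rl_derivative_abel:
  assumes x_cont: "continuous_on {0<..} x" and x_0: "x 0 = 0" and c: "c \<ge> 0"
    and x_eq: "\<And>t. t > 0 \<Longrightarrow> x t = c * t powr (\<beta> - 1) + 1 / Gamma \<beta> * abel_integral \<beta> g t"
    and bdd: "\<And>s. s \<ge> 1 \<Longrightarrow> g s \<le> B"
  shows "has_rl_derivative \<beta> x g"
  unfolding has_rl_derivative_def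
proof (intro conjI allI impI)
  note rl = rl_integral_abel[OF x_cont x_0 c x_eq]
  show "rl_integrable (1 - \<beta>) x t" if "t > 0" for t using rl(1) that by blast
  have "(\<Sum>(a, b)\<in>P. \<bar>rl_integral (1 - \<beta>) x b - rl_integral (1 - \<beta>) x a\<bar>)
      = (\<Sum>(a, b)\<in>P. \<bar>(c * Gamma \<beta> + primitive b) - (c * Gamma \<beta> + primitive a)\<bar>)"
    if sub: "P \<subseteq> {(a, b). a \<in> {0<..} \<and> b \<in> {0<..} \<and> a < b}" for P
  proof (rule sum.cong[OF refl])
    fix z assume "z \<in> P"
    then obtain a b where "z = (a, b)" "0 < a" "0 < b" using sub by auto
    thus "(case z of (a, b) \<Rightarrow> \<bar>rl_integral (1 - \<beta>) x b - rl_integral (1 - \<beta>) x a\<bar>)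
       = (case z of (a, b) \<Rightarrow> \<bar>(c * Gamma \<beta> + primitive b) - (c * Gamma \<beta> + primitive a)\<bar>)"
      using rl(2) by simp
  qed
  thus "abs_continuous_on {0<..} (rl_integral (1 - \<beta>) x)"
    using primitive_abs_continuous[OF bdd, of "c * Gamma \<beta>"] unfolding abs_continuous_on_def
    by (simp cong: conj_cong)
  fix t :: real assume t: "t > 0"
  have "((\<lambda>u. c * Gamma \<beta> + primitive u) has_real_derivative 0 + g t) (at t)"
    by (intro DERIV_add DERIV_const primitive_has_derivative t)
  hence "((\<lambda>u. c * Gamma \<beta> + primitive u) has_real_derivative g t) (at t)" by simp
  thus "(rl_integral (1 - \<beta>) x has_real_derivative g t) (at t)"
  proof (rule has_field_derivative_transform_within_open)
    show "open {0 :: real<..}" "t \<in> {0<..}" using t by auto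
  qed (use rl(2) in auto)
qed

end

section \<open>The fractional initial value problem\<close>

lemma rpow_le_1_plus:
  assumes "0 \<le> \<mu>" "\<mu> \<le> 1" "u \<ge> 0"
  shows "rpow u \<mu> \<le> 1 + u"
proof (cases "u \<le> 1")
  case True
  have "u powr \<mu> \<le> 1" using True assms by (intro powr_le1) auto
  thus ?thesis using assms by (auto simp: rpow_def)
next
  case False
  have "u powr \<mu> \<le> u powr 1" using False assms by (intro powr_mono) auto
  thus ?thesis using assms by (auto simp: rpow_def)
qed

text \<open>This identity is the reason for the weight \<open>t powr ((1 - \<mu>) * (1 - \<beta>))\<close> on \<open>l\<close>. It includes
  \<open>u = 0\<close> with \<open>\<mu> = 0\<close>, where \<open>rpow\<close> takes the value \<open>1\<close>.\<close>

lemma rpow_scaled: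
  assumes "s > 0" "u \<ge> 0"
  shows "s powr (1 - \<beta>) * rpow (s powr (\<beta> - 1) * u) \<mu> = s powr ((1 - \<mu>) * (1 - \<beta>)) * rpow u \<mu>"
proof (cases "\<mu> = 0")
  case False
  have "s powr (1 - \<beta>) * (s powr (\<beta> - 1) * u) powr \<mu>
      = (s powr (1 - \<beta>) * s powr ((\<beta> - 1) * \<mu>)) * u powr \<mu>"
    by (simp add: powr_mult powr_powr)
  also have "s powr (1 - \<beta>) * s powr ((\<beta> - 1) * \<mu>) = s powr ((1 - \<mu>) * (1 - \<beta>))"
    by (subst powr_add[symmetric]) (simp add: algebra_simps)
  finally show ?thesis using False by (simp add: rpow_def)
qed (simp add: rpow_def)

lemma powr_sum_le:
  fixes a b p :: real
  assumes "a \<ge> 0" "b \<ge> 0" "p > 0"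
  shows "(a + b) powr p \<le> 2 powr p * (a powr p + b powr p)"
proof -
  have "(a + b) powr p \<le> (2 * max a b) powr p" using assms by (intro powr_mono2) auto
  also have "\<dots> = 2 powr p * max a b powr p" by (rule powr_mult)
  also have "max a b powr p \<le> a powr p + b powr p" by (auto simp: max_def)
  finally show ?thesis by simp
qed

text \<open>The condition on \<open>f\<close> concerns completed Lebesgue measure; continuity on \<open>(0, \<infinity>)\<close> supplies the
  Borel measurability needed to pass to the uncompleted measure.\<close>

lemma Lp_loc_integrable:
  assumes "f \<in> Lp_loc p" "continuous_on {0<..} f"
  shows "integrable lborel (\<lambda>s. indicator {0<..R} s * \<bar>f s\<bar> powr p)"
proof -
  have "is_interval {0<..R}" "bounded {0<..R}" "{0<..R} \<subseteq> {0..}" by (auto simp: is_interval_oc)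
  hence "set_integrable lebesgue {0<..R} (\<lambda>t. \<bar>f t\<bar> powr p)"
    using assms(1) unfolding Lp_loc_def by blast
  hence int: "integrable lebesgue (\<lambda>s. indicator {0<..R} s * \<bar>f s\<bar> powr p)"
    by (simp add: set_integrable_def)
  have [measurable]: "(\<lambda>s. indicator {0<..} s * f s) \<in> borel_measurable borel"
    using assms(2) by (rule borel_measurable_indicator_times) auto
  have "(\<lambda>s. indicator {0<..R} s * \<bar>indicator {0<..} s * f s\<bar> powr p) \<in> borel_measurable borel"
    by measurable
  also have "(\<lambda>s. indicator {0<..R} s * \<bar>indicator {0<..} s * f s\<bar> powr p)
      = (\<lambda>s. indicator {0<..R} s * \<bar>f s\<bar> powr p)"
    by (auto simp: indicator_def fun_eq_iff)
  finally show ?thesis using int by (subst (asm) integrable_completion) auto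
qed

lemma continuous_on_powr_times_cancel:
  fixes f :: "real \<Rightarrow> real"
  assumes "continuous_on {0<..} (\<lambda>t. t powr a * f t)"
  shows "continuous_on {0<..} f"
proof -
  have "continuous_on {0<..} (\<lambda>t. t powr (- a) * (t powr a * f t))"
    by (intro continuous_on_mult assms continuous_on_powr continuous_on_id continuous_on_const) auto
  moreover have "t powr (- a) * (t powr a * f t) = f t" if "t \<in> {0<..}" for t
    using that by (simp add: mult.assoc[symmetric] powr_add[symmetric])
  ultimately show ?thesis using continuous_on_cong[OF refl] by (metis (no_types, lifting))
qed

lemma Gamma_reflection_real:
  "Gamma x * Gamma (1 - x) = pi / sin (pi * (x :: real))"
proof -
  have "complex_of_real (Gamma x * Gamma (1 - x)) = complex_of_real (pi / sin (pi * x))"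
    using Gamma_reflection_complex[of "complex_of_real x"]
    by (simp add: Gamma_complex_of_real[symmetric] sin_of_real[symmetric])
  thus ?thesis by (simp only: of_real_eq_iff)
qed

theorem theorem3p6:
  fixes \<beta> \<gamma> \<mu> x\<^sub>0 p b :: real and l k \<phi> :: "real \<Rightarrow> real"
  assumes "0 < \<beta>" and "\<beta> < \<gamma>" and "\<gamma> < 1"
    and "0 \<le> \<mu>" and "\<mu> \<le> 1"
    and "x\<^sub>0 > 0" and "p > 1 / \<beta>"
    and l_nonneg: "\<And>t. t > 0 \<Longrightarrow> l t \<ge> 0"
    and l_cont: "continuous_on {0<..} (\<lambda>t. t powr ((1 - \<mu>) * (1 - \<beta>)) * l t)"
    and l_Lp: "(\<lambda>t. t powr ((1 - \<mu>) * (1 - \<beta>)) * l t) \<in> Lp_loc p"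
    and l_decay: "\<exists>K\<ge>0. \<forall>t\<ge>1. t powr \<gamma> * l t \<le> K"
    and k_nonneg: "\<And>t. t > 0 \<Longrightarrow> k t \<ge> 0"
    and k_cont: "continuous_on {0<..} (\<lambda>t. t powr (1 - \<beta>) * k t)"
    and k_Lp: "(\<lambda>t. t powr (1 - \<beta>) * k t) \<in> Lp_loc p"
    and k_lim: "((\<lambda>t. t powr \<beta> * k t) \<longlongrightarrow> b) at_top"
    and "b \<ge> 0"
    and phi_nonneg: "\<And>u. u \<ge> 0 \<Longrightarrow> \<phi> u \<ge> 0"
    and phi_cont: "continuous_on {0..} \<phi>"
    and phi_growth: "\<exists>M\<ge>0. \<forall>u\<ge>0. \<bar>\<phi> u\<bar> \<le> M * rpow u \<mu>"
  shows "\<exists>x \<in> C_plus (1 - \<beta>).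
           has_rl_derivative \<beta> x (\<lambda>t. l t * \<phi> (x t) + k t) \<and>
           ((\<lambda>t. t powr (1 - \<beta>) * x t) \<longlongrightarrow> x\<^sub>0) (at_right 0) \<and>
           (x \<longlongrightarrow> b * pi / (Gamma \<beta> * sin (\<beta> * pi))) at_top"
proof -
  have beta: "0 < \<beta>" "\<beta> < 1" using assms by auto
  have Gpos: "Gamma \<beta> > 0" using beta by simp
  have p0: "p > 0"
  proof -
    have "1 / \<beta> > 0" using beta by simp
    thus ?thesis using \<open>p > 1 / \<beta>\<close> by linarith
  qed
  obtain M where M: "M \<ge> 0" "\<And>u. u \<ge> 0 \<Longrightarrow> \<phi> u \<le> M * rpow u \<mu>"
    using phi_growth by (auto simp: abs_le_iff)
  obtain C\<^sub>l where C\<^sub>l: "C\<^sub>l \<ge> 0" "\<And>t. t \<ge> 1 \<Longrightarrow> t powr \<gamma> * l t \<le> C\<^sub>l" using l_decay by blast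
  define L where "L t = t powr ((1 - \<mu>) * (1 - \<beta>)) * l t" for t
  define \<kappa> where "\<kappa> t = t powr (1 - \<beta>) * k t" for t
  define H where "H s = indicator {0<..} s * ((M * L s + \<kappa> s) / Gamma \<beta>)" for s
  define F where "F s u = s powr (1 - \<beta>) * (l s * \<phi> (s powr (\<beta> - 1) * u) + k s) / Gamma \<beta>" for s u
  have L0: "L s \<ge> 0" and \<kappa>0: "\<kappa> s \<ge> 0" if "s > 0" for s
    using l_nonneg[OF that] k_nonneg[OF that] by (auto simp: L_def \<kappa>_def)
  have Lcont: "continuous_on {0<..} L" and \<kappa>cont: "continuous_on {0<..} \<kappa>"
    using l_cont k_cont by (simp_all add: L_def[abs_def] \<kappa>_def[abs_def])
  have lcont: "continuous_on {0<..} l" and kcont: "continuous_on {0<..} k"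
    using l_cont k_cont by (auto intro: continuous_on_powr_times_cancel)
  have "continuous_on {0<..} (\<lambda>s. (M * L s + \<kappa> s) / Gamma \<beta>)"
    using Lcont \<kappa>cont Gpos
    by (intro continuous_on_divide continuous_on_add continuous_on_mult continuous_on_const) auto
  hence H_meas [measurable]: "H \<in> borel_measurable borel"
    unfolding H_def by (rule borel_measurable_indicator_times) auto
  have H_powr: "integrable lborel (\<lambda>s. indicator {0<..R} s * H s powr p)" for R
  proof (rule Bochner_Integration.integrable_bound)
    show "integrable lborel (\<lambda>s. (2 / Gamma \<beta>) powr p * (M powr p * (indicator {0<..R} s * \<bar>L s\<bar> powr p)
        + indicator {0<..R} s * \<bar>\<kappa> s\<bar> powr p))"
      using Lp_loc_integrable[of L p R] Lp_loc_integrable[of \<kappa> p R] l_Lp k_Lp Lcont \<kappa>cont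
      by (simp add: L_def[abs_def] \<kappa>_def[abs_def])
    show "(\<lambda>s. indicator {0<..R} s * H s powr p) \<in> borel_measurable lborel" by measurable
    show "AE s in lborel. norm (indicator {0<..R} s * H s powr p)
      \<le> norm ((2 / Gamma \<beta>) powr p * (M powr p * (indicator {0<..R} s * \<bar>L s\<bar> powr p)
        + indicator {0<..R} s * \<bar>\<kappa> s\<bar> powr p))"
    proof (intro AE_I2)
      fix s
      show "norm (indicator {0<..R} s * H s powr p)
      \<le> norm ((2 / Gamma \<beta>) powr p * (M powr p * (indicator {0<..R} s * \<bar>L s\<bar> powr p)
        + indicator {0<..R} s * \<bar>\<kappa> s\<bar> powr p))"
      proof (cases "0 < s \<and> s \<le> R")
        case True
        have "H s powr p = (M * L s + \<kappa> s) powr p / Gamma \<beta> powr p"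
          using True L0 \<kappa>0 M Gpos by (simp add: H_def powr_divide)
        also have "\<dots> \<le> 2 powr p * ((M * L s) powr p + \<kappa> s powr p) / Gamma \<beta> powr p"
          using True L0 \<kappa>0 M p0 by (intro divide_right_mono powr_sum_le) auto
        also have "\<dots> = (2 / Gamma \<beta>) powr p * (M powr p * \<bar>L s\<bar> powr p + \<bar>\<kappa> s\<bar> powr p)"
          using True L0 \<kappa>0 M Gpos by (simp add: powr_divide powr_mult)
        finally show ?thesis using True by simp
      qed auto
    qed
  qed
  interpret abel_volterra \<beta> p H F "x\<^sub>0"
  proof
    show "H \<in> borel_measurable borel" by (rule H_meas)
    show "0 \<le> H s" for s
      using L0[of s] \<kappa>0[of s] M Gpos by (auto simp: H_def indicator_def)
    show "integrable lborel (\<lambda>s. indicator {0<..R} s * H s powr p)" for R by (rule H_powr)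
    show "continuous_on ({0<..} \<times> {0..}) (\<lambda>(s, u). F s u)"
    proof -
      let ?S = "{0<..} \<times> {0..} :: (real \<times> real) set"
      have s: "continuous_on ?S (\<lambda>z. h (fst z))" if "continuous_on {0<..} h" for h :: "real \<Rightarrow> real"
        by (rule continuous_on_compose2[OF that continuous_on_fst[OF continuous_on_id]])
          (simp add: image_subset_iff mem_Times_iff)
      have pw: "continuous_on {0<..} (\<lambda>s::real. s powr a)" for a
        by (intro continuous_on_powr continuous_on_id continuous_on_const) auto
      have arg: "continuous_on ?S (\<lambda>z. fst z powr (\<beta> - 1) * snd z)"
        by (intro continuous_on_mult s[OF pw] continuous_on_snd[OF continuous_on_id])
      have "continuous_on ?S (\<lambda>z. \<phi> (fst z powr (\<beta> - 1) * snd z))"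
        by (rule continuous_on_compose2[OF phi_cont arg]) (simp add: image_subset_iff mem_Times_iff)
      hence "continuous_on ?S (\<lambda>z. fst z powr (1 - \<beta>) * (l (fst z) * \<phi> (fst z powr (\<beta> - 1) * snd z) + k (fst z)) / Gamma \<beta>)"
        using Gpos
        by (intro continuous_on_divide continuous_on_add continuous_on_mult continuous_on_const
            s[OF pw] s[OF lcont] s[OF kcont]) auto
      thus ?thesis by (simp add: F_def[abs_def] split_beta)
    qed
    fix s u :: real assume s: "s > 0" and u: "u \<ge> 0"
    have arg: "s powr (\<beta> - 1) * u \<ge> 0" using u by simp
    show "0 \<le> F s u"
      using l_nonneg[OF s] k_nonneg[OF s] phi_nonneg[OF arg] Gpos by (simp add: F_def)
    have "l s * \<phi> (s powr (\<beta> - 1) * u) \<le> l s * (M * rpow (s powr (\<beta> - 1) * u) \<mu>)"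
      using M(2)[OF arg] l_nonneg[OF s] by (rule mult_left_mono)
    hence "s powr (1 - \<beta>) * (l s * \<phi> (s powr (\<beta> - 1) * u))
        \<le> s powr (1 - \<beta>) * (l s * (M * rpow (s powr (\<beta> - 1) * u) \<mu>))"
      by (rule mult_left_mono) simp
    also have "\<dots> = M * l s * (s powr (1 - \<beta>) * rpow (s powr (\<beta> - 1) * u) \<mu>)" by simp
    also have "\<dots> = M * L s * rpow u \<mu>" unfolding rpow_scaled[OF s u] by (simp add: L_def)
    also have "\<dots> \<le> M * L s * (1 + u)"
      using M L0[OF s] u assms by (intro mult_left_mono rpow_le_1_plus) auto
    finally have "s powr (1 - \<beta>) * (l s * \<phi> (s powr (\<beta> - 1) * u)) \<le> M * L s * (1 + u)" .
    moreover have "\<kappa> s \<le> \<kappa> s * (1 + u)" using \<kappa>0[OF s] u by (simp add: algebra_simps)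
    ultimately have "s powr (1 - \<beta>) * (l s * \<phi> (s powr (\<beta> - 1) * u) + k s) \<le> (M * L s + \<kappa> s) * (1 + u)"
      by (simp add: algebra_simps \<kappa>_def)
    hence "F s u \<le> (M * L s + \<kappa> s) * (1 + u) / Gamma \<beta>"
      unfolding F_def using Gpos by (intro divide_right_mono) auto
    thus "F s u \<le> H s * (1 + u)" using s by (simp add: H_def)
  qed (use beta assms in auto)
  \<comment> \<open>The two weights in \<open>K\<close> and \<open>F\<close> cancel, so the fixed point equation for \<open>y\<close> is the Abel equation
    for \<open>x t = t powr (\<beta> - 1) * y t\<close>. As \<open>0 powr (\<beta> - 1) = 0\<close>, also \<open>x 0 = 0\<close>.\<close>
  obtain y where y: "admissible y" and y_eq: "\<And>t. t \<ge> 0 \<Longrightarrow> y t = volterra_op y t"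
    using volterra_solution_exists by blast
  have y_cont: "continuous_on {0..} y" and y0: "\<And>t. t \<ge> 0 \<Longrightarrow> y t \<ge> 0"
    using y unfolding admissible_def by blast+
  define x where "x t = t powr (\<beta> - 1) * y t" for t
  define g where "g t = l t * \<phi> (x t) + k t" for t
  have x0: "x t \<ge> 0" if "t > 0" for t using y0[of t] that by (simp add: x_def)
  have xy: "t powr (1 - \<beta>) * x t = y t" if "t > 0" for t
    using that by (simp add: x_def mult.assoc[symmetric] powr_add[symmetric])
  have x_cont: "continuous_on {0<..} x"
    unfolding x_def
    by (intro continuous_on_mult continuous_on_powr continuous_on_id continuous_on_const
        continuous_on_subset[OF y_cont]) auto
  have g_cont: "continuous_on {0<..} g"
    unfolding g_def
  proof (intro continuous_on_add continuous_on_mult lcont kcont)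
    show "continuous_on {0<..} (\<lambda>t. \<phi> (x t))"
      by (rule continuous_on_compose2[OF phi_cont x_cont]) (use x0 in \<open>simp add: image_subset_iff\<close>)
  qed
  have KF: "K t s * F s (y s) = t powr (1 - \<beta>) / Gamma \<beta> * abel_integrand \<beta> g t s" for t s
  proof (cases "0 < s \<and> s < t")
    case True
    hence "s powr (\<beta> - 1) * s powr (1 - \<beta>) = 1" by (simp add: powr_add[symmetric])
    hence "K t s * F s (y s) = t powr (1 - \<beta>) * (t - s) powr (\<beta> - 1) * g s / Gamma \<beta>"
      using True by (simp add: abel_kernel_def F_def g_def x_def)
    thus ?thesis using True by (simp add: abel_integrand_def)
  qed (auto simp: abel_kernel_def abel_integrand_def)
  interpret g: abel_source \<beta> g
  proof
    show "continuous_on {0<..} g" by (rule g_cont)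
    show "0 \<le> g s" if "s > 0" for s
      using l_nonneg[OF that] k_nonneg[OF that] phi_nonneg[OF x0[OF that]] by (simp add: g_def)
    fix t :: real assume t: "t > 0"
    have "integrable lborel (\<lambda>s. Gamma \<beta> * t powr (\<beta> - 1) * (K t s * F s (y s)))"
      using volterra_integrable[OF y, of t] t by (intro integrable_mult_right) auto
    also have "(\<lambda>s. Gamma \<beta> * t powr (\<beta> - 1) * (K t s * F s (y s))) = abel_integrand \<beta> g t"
    proof
      fix s
      have "t powr (\<beta> - 1) * t powr (1 - \<beta>) = 1" using t by (simp add: powr_add[symmetric])
      thus "Gamma \<beta> * t powr (\<beta> - 1) * (K t s * F s (y s)) = abel_integrand \<beta> g t s"
        unfolding KF using Gpos by (simp add: field_simps)
    qed
    finally show "integrable lborel (abel_integrand \<beta> g t)" .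
  qed (use beta in auto)
  have x_eq: "x t = x\<^sub>0 * t powr (\<beta> - 1) + 1 / Gamma \<beta> * abel_integral \<beta> g t" if t: "t > 0" for t
  proof -
    have "y t = x\<^sub>0 + t powr (1 - \<beta>) / Gamma \<beta> * abel_integral \<beta> g t"
      using y_eq[of t] t unfolding volterra_op_def KF abel_integral_def by simp
    moreover have "t powr (\<beta> - 1) * t powr (1 - \<beta>) = 1" using t by (simp add: powr_add[symmetric])
    ultimately show ?thesis unfolding x_def by (simp add: algebra_simps)
  qed
  have phi_le: "l t * \<phi> (x t) \<le> C\<^sub>l * M * t powr (- \<gamma>) * (1 + x t)" if t: "t \<ge> 1" for t
  proof -
    have t0: "t > 0" using t by simp
    have "t powr (- \<gamma>) * (t powr \<gamma> * l t) \<le> t powr (- \<gamma>) * C\<^sub>l"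
      using C\<^sub>l(2)[OF t] by (intro mult_left_mono) auto
    moreover have "t powr (- \<gamma>) * (t powr \<gamma> * l t) = l t"
      using t0 by (simp add: mult.assoc[symmetric] powr_add[symmetric])
    ultimately have l: "l t \<le> C\<^sub>l * t powr (- \<gamma>)" by (metis mult.commute)
    have "\<phi> (x t) \<le> M * (1 + x t)"
      using M(2)[OF x0[OF t0]] mult_left_mono[OF rpow_le_1_plus[of \<mu> "x t"] M(1)] x0[OF t0] assms by simp
    hence "l t * \<phi> (x t) \<le> (C\<^sub>l * t powr (- \<gamma>)) * (M * (1 + x t))"
      using l phi_nonneg[OF x0[OF t0]] C\<^sub>l by (intro mult_mono) auto
    thus ?thesis by (simp add: mult_ac)
  qed
  have "\<exists>C. \<forall>t\<ge>1. x t \<le> C"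
  proof (rule g.abel_solution_bounded[OF x_cont x0 x_eq])
    have "eventually (\<lambda>s. s powr \<beta> * k s < b + 1) at_top"
      using k_lim by (rule order_tendstoD) simp
    thus "eventually (\<lambda>s. g s \<le> C\<^sub>l * M * s powr (- \<gamma>) * (1 + x s) + (b + 1) * s powr (- \<beta>)) at_top"
      using eventually_ge_at_top[of 1]
    proof eventually_elim
      case (elim s)
      have "s powr (- \<beta>) * (s powr \<beta> * k s) \<le> s powr (- \<beta>) * (b + 1)"
        using elim by (intro mult_left_mono) auto
      moreover have "s powr (- \<beta>) * (s powr \<beta> * k s) = k s"
        using elim by (simp add: mult.assoc[symmetric] powr_add[symmetric])
      ultimately have "k s \<le> (b + 1) * s powr (- \<beta>)" by (metis mult.commute)
      thus ?case using phi_le[OF elim(2)] by (simp add: g_def)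
    qed
  qed (use assms Gpos M C\<^sub>l in auto)
  then obtain C where C: "\<And>t. t \<ge> 1 \<Longrightarrow> x t \<le> C" by blast
  have phi_le': "l t * \<phi> (x t) \<le> C\<^sub>l * M * (1 + C) * t powr (- \<gamma>)" if t: "t \<ge> 1" for t
  proof -
    have "C\<^sub>l * M * t powr (- \<gamma>) * (1 + x t) \<le> C\<^sub>l * M * t powr (- \<gamma>) * (1 + C)"
      using C[OF t] C\<^sub>l M by (intro mult_left_mono) auto
    thus ?thesis using phi_le[OF t] by (simp add: mult_ac)
  qed
  have "((\<lambda>t. t powr \<beta> * (l t * \<phi> (x t))) \<longlongrightarrow> 0) at_top"
  proof (rule tendsto_sandwich[OF _ _ tendsto_const])
    have "((\<lambda>t. C\<^sub>l * M * (1 + C) * t powr (\<beta> - \<gamma>)) \<longlongrightarrow> C\<^sub>l * M * (1 + C) * 0) at_top"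
      using assms by (intro tendsto_mult_left tendsto_neg_powr filterlim_ident) auto
    thus "((\<lambda>t. C\<^sub>l * M * (1 + C) * t powr (\<beta> - \<gamma>)) \<longlongrightarrow> 0) at_top" by simp
    show "eventually (\<lambda>t. 0 \<le> t powr \<beta> * (l t * \<phi> (x t))) at_top"
      using eventually_gt_at_top[of 0]
      by eventually_elim (simp add: l_nonneg phi_nonneg x0)
    show "eventually (\<lambda>t. t powr \<beta> * (l t * \<phi> (x t)) \<le> C\<^sub>l * M * (1 + C) * t powr (\<beta> - \<gamma>)) at_top"
      using eventually_ge_at_top[of 1]
    proof eventually_elim
      case (elim t)
      have "t powr \<beta> * (l t * \<phi> (x t)) \<le> t powr \<beta> * (C\<^sub>l * M * (1 + C) * t powr (- \<gamma>))"
        using phi_le'[OF elim] by (intro mult_left_mono) auto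
      also have "\<dots> = C\<^sub>l * M * (1 + C) * (t powr \<beta> * t powr (- \<gamma>))" by simp
      also have "t powr \<beta> * t powr (- \<gamma>) = t powr (\<beta> - \<gamma>)" by (simp add: powr_add[symmetric])
      finally show ?case .
    qed
  qed
  from tendsto_add[OF this k_lim] have g_lim: "((\<lambda>t. t powr \<beta> * g t) \<longlongrightarrow> b) at_top"
    by (simp add: g_def algebra_simps)
  obtain B where B: "\<And>s. s \<ge> 1 \<Longrightarrow> g s \<le> B" using g.g_bounded[OF g_lim] by blast
  have "has_rl_derivative \<beta> x g"
  proof (rule g.has_rl_derivative_abel[OF x_cont _ _ x_eq B])
    show "x 0 = 0" by (simp add: x_def)
  qed (use assms in auto)
  moreover have "x \<in> C_plus (1 - \<beta>)"
    unfolding C_plus_def using x_cont x0 y_cont y0 xy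
    by (auto intro!: exI[of _ y])
  moreover have "((\<lambda>t. t powr (1 - \<beta>) * x t) \<longlongrightarrow> x\<^sub>0) (at_right 0)"
  proof -
    have "y 0 = x\<^sub>0" using y_eq[of 0] by (simp add: volterra_op_def abel_kernel_def)
    moreover have "(y \<longlongrightarrow> y 0) (at 0 within {0..})" using y_cont by (simp add: continuous_on_def)
    hence "(y \<longlongrightarrow> y 0) (at_right 0)" by (rule tendsto_within_subset) auto
    moreover have "eventually (\<lambda>t. y t = t powr (1 - \<beta>) * x t) (at_right 0)"
      using eventually_at_right_less[of 0] by eventually_elim (simp add: xy)
    ultimately show ?thesis using Lim_transform_eventually by fastforce
  qed
  moreover have "(x \<longlongrightarrow> b * pi / (Gamma \<beta> * sin (\<beta> * pi))) at_top"
  proof -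
    have "((\<lambda>t. x\<^sub>0 * t powr (\<beta> - 1) + 1 / Gamma \<beta> * abel_integral \<beta> g t)
        \<longlongrightarrow> x\<^sub>0 * 0 + 1 / Gamma \<beta> * (b * Beta \<beta> (1 - \<beta>))) at_top"
      using beta by (intro tendsto_add tendsto_mult_left tendsto_neg_powr filterlim_ident
          g.abel_integral_tendsto g_lim) auto
    moreover have "x\<^sub>0 * 0 + 1 / Gamma \<beta> * (b * Beta \<beta> (1 - \<beta>)) = b * pi / (Gamma \<beta> * sin (\<beta> * pi))"
      using Gamma_reflection_real[of \<beta>] by (simp add: Beta_def mult.commute)
    moreover have "eventually (\<lambda>t. x\<^sub>0 * t powr (\<beta> - 1) + 1 / Gamma \<beta> * abel_integral \<beta> g t = x t) at_top"
      using eventually_gt_at_top[of 0] by eventually_elim (simp add: x_eq)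
    ultimately show ?thesis using Lim_transform_eventually by fastforce
  qed
  ultimately show ?thesis unfolding g_def by blast
qed

end
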